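(* Let $X$ and $Y$ be Polish spaces, $\pi\colon X\to Y$ continuous, $L\colon X\to\overline{\mathbb R}_+$ lower semicontinuous, and $H\colon X\times X\to\overline{\mathbb R}_+$ Borel measurable. Assume that: (i) the function $(x,\tilde x)\mapsto L(x)+L(\tilde x)+H(x,\tilde x)$ is lower semicontinuous on $X\times X$; (ii) there exists $\kappa>0$ such that for every $y\in Y$ there exists $x\in X$ with $\pi(x)=y$ and $L(x)\le\kappa$; (iii) for every $\kappa>0$, the set $\{x\in X : L(x)\le\kappa\}$ is compact; (iv) there exists $C>0$ such that $H(x,\tilde x)\le C(L(x)+L(\tilde x)+1)$ for all $(x,\tilde x)\in X\times X$. Then, for every $m_0\in\mathcal P(Y)$, the function $\mathcal J$ admits a minimizer in $\mathcal P_{m_0}(X)$. As a consequence, if in addition $H$ is symmetric, i.e., $H(x,\tilde x)=H(\tilde x,x)$ for all $(x,\tilde x)\in X\times X$, then there exists an equilibrium $Q$ of $\mathrm{NAG}(X,Y,\pi,L,H,m_0)$.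
   Context: $\overline{\mathbb R}_+=[0,+\infty]$. For a Polish space $X$, $\mathcal P(X)$ is the set of Borel probability measures on $X$ with the topology of weak convergence of measures; $\pi_\#Q$ denotes the pushforward. $\mathcal P_{m_0}(X)=\{Q\in\mathcal P(X):\pi_\#Q=m_0\}$. Individual cost: $F(x,Q)=L(x)+\int_X H(x,\tilde x)\,\mathrm dQ(\tilde x)$. Potential: $\mathcal J(Q)=\int_{X\times X}\bigl(L(x)+L(\tilde x)+H(x,\tilde x)\bigr)\,\mathrm d(Q\otimes Q)(x,\tilde x)\in\overline{\mathbb R}_+$ for $Q\in\mathcal P(X)$. Equilibrium: $Q\in\mathcal P(X)$ is an equilibrium of $\mathrm{NAG}(X,Y,\pi,L,H,m_0)$ if $\pi_\#Q=m_0$, $\int_X F(x,Q)\,\mathrm dQ(x)<+\infty$, and for $Q$-almost every $x\in X$ one has $F(x,Q)=\inf\{F(z,Q): z\in X,\ \pi(z)=\pi(x)\}$. *)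

theory Defs
  imports "HOL-Probability.Probability"
begin

definition lower_semicontinuous :: "('a::topological_space \<Rightarrow> ennreal) \<Rightarrow> bool" where
  "lower_semicontinuous f \<longleftrightarrow> (\<forall>c. open {x. c < f x})"

definition prob_measures :: "'a::topological_space measure set" where
  "prob_measures = {Q. sets Q = sets borel \<and> prob_space Q}"

definition prob_measures_with_marginal ::
  "('a::topological_space \<Rightarrow> 'b::topological_space) \<Rightarrow> 'b measure \<Rightarrow> 'a measure set" where
  "prob_measures_with_marginal \<pi> m\<^sub>0 = {Q \<in> prob_measures. distr Q borel \<pi> = m\<^sub>0}"

definition individual_cost ::
  "('a \<Rightarrow> ennreal) \<Rightarrow> ('a \<times> 'a \<Rightarrow> ennreal) \<Rightarrow> 'a \<Rightarrow> 'a measure \<Rightarrow> ennreal" where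
  "individual_cost L H x Q = L x + (\<integral>\<^sup>+ x'. H (x, x') \<partial>Q)"

definition potential ::
  "('a \<Rightarrow> ennreal) \<Rightarrow> ('a \<times> 'a \<Rightarrow> ennreal) \<Rightarrow> 'a measure \<Rightarrow> ennreal" where
  "potential L H Q = (\<integral>\<^sup>+ (x, x'). L x + L x' + H (x, x') \<partial>(Q \<Otimes>\<^sub>M Q))"

definition is_NAG_equilibrium ::
  "('a::polish_space \<Rightarrow> 'b::polish_space) \<Rightarrow> ('a \<Rightarrow> ennreal) \<Rightarrow> ('a \<times> 'a \<Rightarrow> ennreal) \<Rightarrow>
    'b measure \<Rightarrow> 'a measure \<Rightarrow> bool" where
  "is_NAG_equilibrium \<pi> L H m\<^sub>0 Q \<longleftrightarrow>
     Q \<in> prob_measures \<and> distr Q borel \<pi> = m\<^sub>0 \<and>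
     (\<integral>\<^sup>+ x. individual_cost L H x Q \<partial>Q) < \<infinity> \<and>
     (AE x in Q. individual_cost L H x Q = (INF z\<in>{z. \<pi> z = \<pi> x}. individual_cost L H z Q))"

end

theory Submission
  imports Defs
begin

text \<open>
  A minimizing sequence has bounded \<open>L\<close>-integrals, hence is tight because the sublevels of \<open>L\<close> are
  compact; the potential is lower semicontinuous along a weakly convergent subsequence, so the limit
  is a minimizer. Comparing a minimizer \<open>Q\<close> with the mixtures \<open>(1 - t) Q + t Q'\<close> and using the symmetry
  of \<open>H\<close> shows that \<open>Q\<close> minimizes the linear functional \<open>Q' \<mapsto> \<integral> F(x, Q) dQ'(x)\<close> among the plans with
  the same marginal. The infimum of this functional is the integral of the fibrewise infimum of
  \<open>F(\<cdot>, Q)\<close>, which forces \<open>F(x, Q)\<close> to be equal to its fibrewise infimum for almost every \<open>x\<close>.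
\<close>

section \<open>Random words with prescribed cylinder probabilities\<close>

text \<open>The sum \<open>L x + L x' + H (x, x')\<close> is semicontinuous only as a whole and only
  on the product space. Weak limits are therefore tested on \<open>Q \<Otimes>\<^sub>M Q\<close>,
  and semicontinuity of \<open>individual_cost\<close> in \<open>x\<close> is recovered by
  integrating the sum in \<open>x'\<close> and cancelling the integral of \<open>L\<close>, which is
  finite at a minimizer. Infinite values are the other obstacle. The growth bound on
  \<open>H\<close> makes the potential finite exactly when the integral of \<open>L\<close> is, so
  the potential along a mixture is a real quadratic polynomial in \<open>t\<close>, unless its mixed
  term is infinite and the desired inequality trivial. Symmetry merges the two mixed terms, and the
  sign of the derivative at \<open>t = 0\<close> then gives the comparison of linear costs.
  Attaining the fibrewise infimum by a plan would usually call for a measurable selection of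
  minimizers; here the compactness result behind the minimizer yields that plan too. Applied to
  \<open>L\<close> alone, the same construction provides a plan of finite potential.\<close>

text \<open>Tychonoff in place of a diagonal argument: over a countable index set the cube is
  compact and metrizable, hence sequentially compact. The indices will be words, the values cell
  probabilities.\<close>

lemma pointwise_convergent_subseq:
  fixes p :: "nat \<Rightarrow> 'i::countable \<Rightarrow> real"
  assumes "\<And>n i. p n i \<in> {0..1}"
  obtains r l where "strict_mono (r :: nat \<Rightarrow> nat)" "\<And>i. (\<lambda>n. p (r n) i) \<longlonglongrightarrow> l i"
proof -
  have "compactin (product_topology (\<lambda>_::'i. euclidean) UNIV) (PiE UNIV (\<lambda>_. {0..1::real}))"
    unfolding compactin_PiE by simp
  then have "compact (PiE (UNIV :: 'i set) (\<lambda>_. {0..1::real}))"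
    by (simp add: euclidean_product_topology)
  then have "seq_compact (PiE (UNIV :: 'i set) (\<lambda>_. {0..1::real}))"
    by (simp add: compact_eq_seq_compact_metric)
  moreover have "p n \<in> PiE UNIV (\<lambda>_. {0..1})" for n
    using assms by auto
  ultimately obtain l r where r: "strict_mono (r :: nat \<Rightarrow> nat)" and l: "(p \<circ> r) \<longlonglongrightarrow> l"
    unfolding seq_compact_def by meson
  have "(\<lambda>n. p (r n) i) \<longlonglongrightarrow> l i" for i
  proof -
    have "continuous_on UNIV (\<lambda>x :: 'i \<Rightarrow> real. x i)"
      by (rule continuous_on_product_coordinates)
    then have "isCont (\<lambda>x :: 'i \<Rightarrow> real. x i) l"
      using continuous_on_eq_continuous_at[OF open_UNIV] by blast
    from isCont_tendsto_compose[OF this l] show ?thesis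
      by simp
  qed
  with r show thesis by (rule that)
qed

text \<open>The law of a countably valued map has a density with respect to counting measure, so the
  integral becomes a series whose coefficients are cell probabilities.\<close>

lemma nn_integral_countable_image:
  fixes T :: "'a \<Rightarrow> 'b::countable" and h :: "'b \<Rightarrow> ennreal"
  assumes [measurable]: "T \<in> M \<rightarrow>\<^sub>M count_space UNIV"
  shows "(\<integral>\<^sup>+x. h (T x) \<partial>M) = (\<integral>\<^sup>+z. emeasure M (T -` {z} \<inter> space M) * h z \<partial>count_space UNIV)"
proof -
  have "distr M (count_space UNIV) T =
      density (count_space UNIV) (\<lambda>z. emeasure M (T -` {z} \<inter> space M))"
    by (rule measure_eqI_countable[of _ UNIV])
      (auto simp: emeasure_distr emeasure_density nn_integral_count_space_indicator[symmetric])
  then have "(\<integral>\<^sup>+z. h z \<partial>distr M (count_space UNIV) T) =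
      (\<integral>\<^sup>+z. emeasure M (T -` {z} \<inter> space M) * h z \<partial>count_space UNIV)"
    by (simp add: nn_integral_density)
  then show ?thesis
    by (simp add: nn_integral_distr)
qed

text \<open>The index is the predecessor of the first partial sum that passes \<open>w\<close>.
  Terms \<open>c k = 0\<close> give empty half-open intervals and so do not spoil
  uniqueness.\<close>

lemma nested_interval_step:
  fixes c :: "nat \<Rightarrow> real"
  assumes nonneg: "\<And>k. 0 \<le> c k" and sums: "c sums l" and w: "a \<le> w" "w < a + l"
  shows "\<exists>!k. a + (\<Sum>i<k. c i) \<le> w \<and> w < a + (\<Sum>i<k. c i) + c k"
proof -
  have "(\<lambda>n. a + (\<Sum>i<n. c i)) \<longlonglongrightarrow> a + l"
    using sums unfolding sums_def by (intro tendsto_intros)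
  then have "eventually (\<lambda>n. w < a + (\<Sum>i<n. c i)) sequentially"
    using w by (auto dest: order_tendstoD)
  then obtain n where n: "w < a + (\<Sum>i<n. c i)"
    by (auto simp: eventually_sequentially)
  define m where "m = (LEAST n. w < a + (\<Sum>i<n. c i))"
  have m: "w < a + (\<Sum>i<m. c i)"
    unfolding m_def using n by (rule LeastI)
  with w have "m \<noteq> 0" by (auto intro: ccontr)
  then obtain k where k: "m = Suc k" by (cases m) auto
  have "\<not> w < a + (\<Sum>i<k. c i)"
    using not_less_Least[of k "\<lambda>n. w < a + (\<Sum>i<n. c i)"] k m_def by simp
  with m k have K: "a + (\<Sum>i<k. c i) \<le> w \<and> w < a + (\<Sum>i<k. c i) + c k"
    by (simp add: algebra_simps)
  have mono: "(\<Sum>i<i. c i) + c i \<le> (\<Sum>i<j. c i)" if "i < j" for i j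
    using sum_mono2[of "{..<j}" "{..<Suc i}" c] that nonneg by (simp add: add.commute)
  have "j = k" if "a + (\<Sum>i<j. c i) \<le> w \<and> w < a + (\<Sum>i<j. c i) + c j" for j
    using mono[of j k] mono[of k j] that K by (cases j k rule: linorder_cases) auto
  with K show ?thesis by blast
qed

text \<open>
  The cylinder of a word \<open>s\<close> is realised as a half-open interval of length \<open>p s\<close>;
  the intervals of the one-letter extensions of \<open>s\<close> are placed side by side inside that of \<open>s\<close>.
\<close>

lemma prob_space_of_consistent_weights:
  fixes p :: "nat list \<Rightarrow> real"
  assumes nonneg: "\<And>s. 0 \<le> p s" and Nil: "p [] = 1" and sums: "\<And>s. (\<lambda>k. p (s @ [k])) sums p s"
  obtains M :: "real measure" and N :: "nat \<Rightarrow> real \<Rightarrow> nat list" where "prob_space M"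
    "\<And>j. N j \<in> M \<rightarrow>\<^sub>M count_space UNIV"
    "\<And>w. N 0 w = []"
    "\<And>j w. \<exists>k. N (Suc j) w = N j w @ [k]"
    "\<And>s. emeasure M (N (length s) -` {s} \<inter> space M) = p s"
    "\<And>j w. w \<in> space M \<Longrightarrow> 0 < p (N j w)"
proof -
  \<comment> \<open>Left endpoint: for each position \<open>j\<close> of \<open>s\<close>, the total
    length of the siblings of the prefix that carry a smaller letter there.\<close>
  define a where "a s = (\<Sum>j<length s. \<Sum>i<s ! j. p (take j s @ [i]))" for s
  define I where "I s = {a s ..< a s + p s}" for s
  have a_snoc: "a (s @ [k]) = a s + (\<Sum>i<k. p (s @ [i]))" for s k
    by (simp add: a_def nth_append)
  have step: "\<exists>!k. w \<in> I (s @ [k])" if "w \<in> I s" for w s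
    using nested_interval_step[of "\<lambda>k. p (s @ [k])" "p s" "a s" w] nonneg sums that
    by (simp add: I_def a_snoc)
  have sub: "I (s @ [k]) \<subseteq> I s" for s k
  proof -
    have "(\<Sum>i<Suc k. p (s @ [i])) \<le> p s"
      using sum_le_suminf[of "\<lambda>k. p (s @ [k])" "{..<Suc k}"] sums[of s] nonneg
      by (auto simp: sums_iff)
    moreover have "0 \<le> (\<Sum>i<k. p (s @ [i]))"
      by (intro sum_nonneg nonneg)
    ultimately show ?thesis
      by (auto simp: I_def a_snoc)
  qed
  \<comment> \<open>This reads off the digits of \<open>w\<close>. Outside \<open>[0, 1)\<close> the
    \<open>THE\<close> is unspecified, but the words still extend one another, so their lengths are
    right for every \<open>w\<close>.\<close>
  define N where "N j w = rec_nat [] (\<lambda>_ s. s @ [THE k. w \<in> I (s @ [k])]) j" for j w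
  have N0: "N 0 w = []" and NS: "N (Suc j) w = N j w @ [THE k. w \<in> I (N j w @ [k])]" for j w
    by (simp_all add: N_def)
  have len: "length (N j w) = j" for j w
    by (induction j) (simp_all add: N0 NS)
  have I_Nil: "I [] = {0..<1}"
    by (simp add: I_def a_def Nil)
  have N_I: "w \<in> I (N j w)" if "w \<in> {0..<1}" for j w
  proof (induction j)
    case 0
    then show ?case using that by (simp add: N0 I_Nil)
  next
    case (Suc j)
    show ?case unfolding NS by (rule theI') (rule step[OF Suc])
  qed
  have I_N: "N (length s) w = s \<and> w \<in> {0..<1}" if "w \<in> I s" for s w
    using that
  proof (induction s rule: rev_induct)
    case Nil
    then show ?case by (simp add: N0 I_Nil)
  next
    case (snoc k s)
    then have s: "w \<in> I s" using sub by blast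
    with snoc.IH have "N (length s) w = s" "w \<in> {0..<1}" by auto
    moreover have "(THE k. w \<in> I (s @ [k])) = k"
      using step[OF s] snoc.prems by (rule the1_equality)
    ultimately show ?case by (simp add: NS)
  qed
  define M where "M = restrict_space lborel {0..<1::real}"
  have space: "space M = {0..<1}"
    by (simp add: M_def space_restrict_space)
  have pre: "N (length s) -` {s} \<inter> space M = I s" for s
    using I_N[of _ s] N_I[of _ "length s"] by (force simp: space)
  have Isub: "I s \<subseteq> {0..<1}" for s
    using I_N by blast
  have em: "emeasure M (I s) = p s" for s
    using Isub nonneg by (simp add: M_def emeasure_restrict_space I_def)
  have sets: "I s \<in> sets M" for s
    using Isub by (auto simp: M_def sets_restrict_space_iff I_def)
  show thesis
  proof (rule that)
    show "prob_space M"
      using em[of "[]"] by (intro prob_spaceI) (simp add: space I_Nil Nil)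
    show "N j \<in> M \<rightarrow>\<^sub>M count_space UNIV" for j
    proof -
      have "N j -` {s} \<inter> space M \<in> sets M" for s
      proof (cases "length s = j")
        case True
        then show ?thesis using pre[of s] sets[of s] by auto
      next
        case False
        then have "N j -` {s} = {}" using len by auto
        then show ?thesis by simp
      qed
      then show ?thesis by (simp add: measurable_count_space_eq_countable)
    qed
    show "N 0 w = []" for w by (rule N0)
    show "\<exists>k. N (Suc j) w = N j w @ [k]" for j w by (simp add: NS)
    show "emeasure M (N (length s) -` {s} \<inter> space M) = p s" for s
      by (simp add: pre em)
    \<comment> \<open>A half-open interval that contains a point has positive length, so words of
      weight zero are never visited.\<close>
    show "0 < p (N j w)" if "w \<in> space M" for j w
      using N_I[of w j] that by (simp add: space I_def)
  qed
qed

section \<open>Weak limits of tight sequences\<close>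

text \<open>\<open>c j x\<close> is the first member of a dense sequence within
  \<open>(1 / 2) ^ j\<close> of \<open>x\<close>, so its level sets partition the space into
  countably many small Borel cells. Choosing the least index bounds it on a compact set by the
  largest index of a finite subcover; tightness will use this to keep mass from escaping to large
  indices.\<close>

lemma dyadic_index:
  obtains d :: "nat \<Rightarrow> 'a::polish_space" and c :: "nat \<Rightarrow> 'a \<Rightarrow> nat" where
    "\<And>j. c j \<in> borel \<rightarrow>\<^sub>M count_space UNIV"
    "\<And>j x. dist (d (c j x)) x < (1 / 2) ^ j"
    "\<And>K j. compact K \<Longrightarrow> \<exists>b. \<forall>x\<in>K. c j x \<le> b"
proof -
  obtain D :: "'a set" where D: "countable D" "\<And>X. open X \<Longrightarrow> X \<noteq> {} \<Longrightarrow> \<exists>d\<in>D. d \<in> X"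
    by (rule countable_dense_setE) blast
  then have "D \<noteq> {}" by (metis empty_iff open_UNIV UNIV_not_empty)
  define d where "d = from_nat_into D"
  have d: "\<exists>n. dist (d n) x < e" if "0 < e" for x e
  proof -
    have "ball x e \<noteq> {}"
      using that by simp
    with D(2)[OF open_ball] obtain y where y: "y \<in> D" "y \<in> ball x e"
      by blast
    then obtain n where "y = d n"
      unfolding d_def using from_nat_into_surj[OF D(1)] by metis
    with y show ?thesis by (auto simp: dist_commute)
  qed
  define c where "c j x = (LEAST n. dist (d n) x < (1 / 2) ^ j)" for j x
  show thesis
  proof (rule that)
    show "c j \<in> borel \<rightarrow>\<^sub>M count_space UNIV" for j
      unfolding c_def by measurable
    show "dist (d (c j x)) x < (1 / 2) ^ j" for j x
      unfolding c_def by (rule LeastI_ex) (simp add: d)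
    show "\<exists>b. \<forall>x\<in>K. c j x \<le> b" if "compact K" for K j
    proof -
      have "K \<subseteq> (\<Union>n\<in>UNIV. ball (d n) ((1 / 2) ^ j))"
        using d[of "(1 / 2) ^ j"] by auto
      then obtain F where F: "finite F" "K \<subseteq> (\<Union>n\<in>F. ball (d n) ((1 / 2) ^ j))"
        using compactE_image[OF \<open>compact K\<close>, of UNIV "\<lambda>n. ball (d n) ((1 / 2) ^ j)"] by auto
      have "c j x \<le> Max F" if "x \<in> K" for x
      proof -
        obtain n where "n \<in> F" "dist (d n) x < (1 / 2) ^ j"
          using F \<open>x \<in> K\<close> by auto
        then have "c j x \<le> n" unfolding c_def by (intro Least_le)
        also have "n \<le> Max F" using F \<open>n \<in> F\<close> by simp
        finally show ?thesis .
      qed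
      then show ?thesis by blast
    qed
  qed
qed

text \<open>Both integrals are series over pairs of values, weighted by products of probabilities,
  so Fatou for counting measure applies once the terms are compared.\<close>

lemma nn_integral_pair_countable_liminf:
  fixes T :: "'a \<Rightarrow> 'c::countable" and S :: "nat \<Rightarrow> 'b \<Rightarrow> 'c" and h :: "'c \<times> 'c \<Rightarrow> ennreal"
  assumes "prob_space M" "\<And>n. prob_space (R n)"
    and [measurable]: "T \<in> M \<rightarrow>\<^sub>M count_space UNIV" "\<And>n. S n \<in> R n \<rightarrow>\<^sub>M count_space UNIV"
    and lim: "\<And>s. (\<lambda>n. emeasure (R n) (S n -` {s} \<inter> space (R n))) \<longlonglongrightarrow> emeasure M (T -` {s} \<inter> space M)"
  shows "(\<integral>\<^sup>+(x, y). h (T x, T y) \<partial>(M \<Otimes>\<^sub>M M))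
    \<le> liminf (\<lambda>n. \<integral>\<^sup>+(x, y). h (S n x, S n y) \<partial>(R n \<Otimes>\<^sub>M R n))"
proof -
  define e where "e s = emeasure M (T -` {s} \<inter> space M)" for s
  define e' where "e' n s = emeasure (R n) (S n -` {s} \<inter> space (R n))" for n s
  have count: "count_space UNIV = (count_space UNIV :: 'c measure) \<Otimes>\<^sub>M (count_space UNIV :: 'c measure)"
    by (simp add: pair_measure_countable)
  have sum: "(\<integral>\<^sup>+(x, y). h (T x, T y) \<partial>(M \<Otimes>\<^sub>M M)) =
      (\<integral>\<^sup>+z. e (fst z) * e (snd z) * h z \<partial>count_space UNIV)"
    if "prob_space M" and [measurable]: "T \<in> M \<rightarrow>\<^sub>M count_space UNIV"
      and e: "\<And>s. e s = emeasure M (T -` {s} \<inter> space M)"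
    for M :: "'d measure" and T :: "'d \<Rightarrow> 'c" and e
  proof -
    interpret prob_space M by fact
    have meas: "(\<lambda>(x, y). (T x, T y)) \<in> M \<Otimes>\<^sub>M M \<rightarrow>\<^sub>M count_space UNIV"
      unfolding count by measurable
    have "(\<lambda>(x, y). (T x, T y)) -` {z} \<inter> space (M \<Otimes>\<^sub>M M) =
        (T -` {fst z} \<inter> space M) \<times> (T -` {snd z} \<inter> space M)" for z
      by (auto simp: space_pair_measure)
    then show ?thesis
      using nn_integral_countable_image[OF meas, of h]
      by (simp add: emeasure_pair_measure_Times e case_prod_beta')
  qed
  have lim': "(\<lambda>n. e' n s) \<longlonglongrightarrow> e s" for s
    using lim by (simp add: e_def e'_def)
  have fin: "e s \<noteq> \<infinity>" for s
    using finite_measure.emeasure_finite[OF prob_space.finite_measure[OF assms(1)]]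
    by (simp add: e_def)
  \<comment> \<open>Since \<open>h z\<close> may be infinite and multiplication is discontinuous at
    \<open>0 * \<infinity>\<close>, the terms are known to converge only when both limit weights are
    positive; otherwise the left side is 0.\<close>
  have "e (fst z) * e (snd z) * h z \<le> liminf (\<lambda>n. e' n (fst z) * e' n (snd z) * h z)" for z
  proof (cases "e (fst z) = 0 \<or> e (snd z) = 0")
    case True
    then show ?thesis by auto
  next
    case False
    have "(\<lambda>n. e' n (fst z) * e' n (snd z) * h z) \<longlonglongrightarrow> e (fst z) * e (snd z) * h z"
      using False fin by (intro tendsto_mult_ennreal lim' tendsto_const)
        (auto simp: ennreal_mult_eq_top_iff)
    then show ?thesis
      by (simp add: lim_imp_Liminf)
  qed
  then have "(\<integral>\<^sup>+z. e (fst z) * e (snd z) * h z \<partial>count_space UNIV)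
      \<le> (\<integral>\<^sup>+z. liminf (\<lambda>n. e' n (fst z) * e' n (snd z) * h z) \<partial>count_space UNIV)"
    by (intro nn_integral_mono)
  also have "\<dots> \<le> liminf (\<lambda>n. \<integral>\<^sup>+z. e' n (fst z) * e' n (snd z) * h z \<partial>count_space UNIV)"
    by (intro nn_integral_liminf) simp
  finally show ?thesis
    using sum[of M T e] sum[of "R n" "S n" "e' n" for n] assms by (simp add: e_def e'_def)
qed

lemma lower_semicontinuous_measurable:
  "lower_semicontinuous f \<Longrightarrow> f \<in> borel_measurable borel"
  unfolding lower_semicontinuous_def by (intro borel_measurableI_greater) simp

text \<open>
  This is Prokhorov's theorem, with weak convergence expressed through lower semicontinuous functions.
  A point is coded by the word of its indices in finer and finer covers; the limits of
  the probabilities of the cells of these codes are consistent by tightness, so they are the law of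
  a random sequence of words, whose limit point is distributed according to the weak limit.
\<close>

lemma tight_lower_semicontinuous_limit:
  fixes Q :: "nat \<Rightarrow> 'a::polish_space measure"
  assumes Q: "\<And>n. Q n \<in> prob_measures"
    and tight: "\<And>e. 0 < e \<Longrightarrow> \<exists>K. compact K \<and> (\<forall>n. measure (Q n) (- K) \<le> e)"
  obtains r R where "strict_mono (r :: nat \<Rightarrow> nat)" "R \<in> prob_measures"
    "\<And>f. lower_semicontinuous f \<Longrightarrow>
      (\<integral>\<^sup>+z. f z \<partial>(R \<Otimes>\<^sub>M R)) \<le> liminf (\<lambda>n. \<integral>\<^sup>+z. f z \<partial>(Q (r n) \<Otimes>\<^sub>M Q (r n)))"
proof -
  have sets_Q[measurable_cong]: "sets (Q n) = sets borel" and prob_Q: "prob_space (Q n)" for n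
    using Q by (auto simp: prob_measures_def)
  have space_Q: "space (Q n) = UNIV" for n
    using sets_eq_imp_space_eq[OF sets_Q] by simp
  obtain d :: "nat \<Rightarrow> 'a" and c where c[measurable]: "\<And>j. c j \<in> borel \<rightarrow>\<^sub>M count_space UNIV"
    and d: "\<And>j x. dist (d (c j x)) x < (1 / 2) ^ j"
    and c_bdd: "\<And>K j. compact K \<Longrightarrow> \<exists>b. \<forall>x\<in>K. c j x \<le> b"
    by (rule dyadic_index) blast
  define word where "word j x = map (\<lambda>i. c i x) [0..<j]" for j x
  have word_Suc: "word (Suc j) x = word j x @ [c j x]" for j x
    by (simp add: word_def)
  have length_word: "length (word j x) = j" for j x
    by (simp add: word_def)
  have take_word: "take i (word j x) = word i x" if "i \<le> j" for i j x
    using that by (simp add: word_def take_map take_upt)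
  define cyl where "cyl s = {x. word (length s) x = s}" for s
  have cyl_alt: "cyl s = {x. \<forall>i<length s. c i x = s ! i}" for s
    unfolding cyl_def list_eq_iff_nth_eq length_word by (simp add: word_def)
  have cyl_snoc: "cyl (s @ [k]) = cyl s \<inter> {x. c (length s) x = k}" for s k
    by (auto simp: cyl_def word_Suc)
  have cyl_meas[measurable]: "cyl s \<in> sets borel" for s
    unfolding cyl_alt by measurable
  have word_pre: "word j -` {s} = (if length s = j then cyl s else {})" for j s
    using length_word by (auto simp: cyl_def)
  have word_meas[measurable]: "word j \<in> borel \<rightarrow>\<^sub>M count_space UNIV" for j
    by (simp add: measurable_count_space_eq_countable word_pre)
  define q where "q n s = measure (Q n) (cyl s)" for n s
  have "\<And>n s. q n s \<in> {0..1}"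
    by (simp add: q_def prob_space.prob_le_1[OF prob_Q])
  then obtain r p where r: "strict_mono (r :: nat \<Rightarrow> nat)" and lim: "\<And>s. (\<lambda>n. q (r n) s) \<longlonglongrightarrow> p s"
    using pointwise_convergent_subseq[of q] by blast
  have q_sum: "(\<Sum>k<b. q n (s @ [k])) = measure (Q n) (cyl s \<inter> {x. c (length s) x < b})" for n s b
  proof (induction b)
    case (Suc b)
    interpret prob_space "Q n" by (rule prob_Q)
    have "cyl s \<inter> {x. c (length s) x < Suc b} =
        (cyl s \<inter> {x. c (length s) x < b}) \<union> cyl (s @ [b])"
      by (auto simp: cyl_snoc)
    moreover have "measure (Q n) ((cyl s \<inter> {x. c (length s) x < b}) \<union> cyl (s @ [b])) =
        measure (Q n) (cyl s \<inter> {x. c (length s) x < b}) + measure (Q n) (cyl (s @ [b]))"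
      by (rule finite_measure_Union) (measurable, auto simp: cyl_snoc)
    ultimately show ?case using Suc by (simp add: q_def)
  qed simp
  have p_nonneg: "0 \<le> p s" for s
    by (rule LIMSEQ_le_const[OF lim]) (simp add: q_def)
  have p_Nil: "p [] = 1"
  proof -
    have "q n [] = 1" for n
      using prob_space.prob_space[OF prob_Q] by (simp add: q_def cyl_def word_def space_Q)
    with lim[of "[]"] show ?thesis by (simp add: LIMSEQ_const_iff)
  qed
  have p_sums: "(\<lambda>k. p (s @ [k])) sums p s" for s
  proof -
    have sum_lim: "(\<lambda>n. \<Sum>k<b. q (r n) (s @ [k])) \<longlonglongrightarrow> (\<Sum>k<b. p (s @ [k]))" for b
      by (intro tendsto_sum lim)
    have upper: "(\<Sum>k<b. p (s @ [k])) \<le> p s" for b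
    proof (rule LIMSEQ_le[OF sum_lim lim], intro exI allI impI)
      fix n
      interpret prob_space "Q (r n)" by (rule prob_Q)
      show "(\<Sum>k<b. q (r n) (s @ [k])) \<le> q (r n) s"
        unfolding q_sum unfolding q_def by (intro finite_measure_mono) auto
    qed
    \<comment> \<open>No mass is lost in the limit: on a compact \<open>K\<close> the next letter is
      at most \<open>b\<close>, so the first \<open>Suc b\<close> children of \<open>s\<close> carry
      all of its mass up to \<open>e\<close>, uniformly in \<open>n\<close>.\<close>
    have lower: "\<exists>b. p s - e \<le> (\<Sum>k<b. p (s @ [k]))" if "0 < e" for e
    proof -
      obtain K where K: "compact K" "\<And>n. measure (Q n) (- K) \<le> e"
        using tight[OF \<open>0 < e\<close>] by blast
      obtain b where b: "\<And>x. x \<in> K \<Longrightarrow> c (length s) x \<le> b"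
        using c_bdd[OF K(1)] by blast
      have [measurable]: "K \<in> sets borel"
        using K(1) by (intro borel_closed compact_imp_closed)
      have "q n s - e \<le> (\<Sum>k<Suc b. q n (s @ [k]))" for n
      proof -
        interpret prob_space "Q n" by (rule prob_Q)
        let ?A = "cyl s \<inter> {x. c (length s) x < Suc b}"
        have "q n s \<le> measure (Q n) (?A \<union> - K)"
          unfolding q_def using b by (intro finite_measure_mono) (auto simp: less_Suc_eq_le)
        also have "\<dots> \<le> measure (Q n) ?A + measure (Q n) (- K)"
          by (intro measure_Un_le) measurable
        finally show ?thesis
          unfolding q_sum using K(2)[of n] by simp
      qed
      then have "p s - e \<le> (\<Sum>k<Suc b. p (s @ [k]))"
        by (intro LIMSEQ_le[OF tendsto_diff[OF lim tendsto_const] sum_lim]) auto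
      then show ?thesis by blast
    qed
    show ?thesis
      unfolding sums_def
    proof (rule LIMSEQ_I)
      fix e :: real assume "0 < e"
      then obtain b where b: "p s - e / 2 \<le> (\<Sum>k<b. p (s @ [k]))"
        using lower[of "e / 2"] by auto
      have "norm ((\<Sum>k<n. p (s @ [k])) - p s) < e" if "b \<le> n" for n
      proof -
        have "(\<Sum>k<b. p (s @ [k])) \<le> (\<Sum>k<n. p (s @ [k]))"
          using that p_nonneg by (intro sum_mono2) auto
        with b upper[of n] \<open>0 < e\<close> show ?thesis by (auto simp: abs_if)
      qed
      then show "\<exists>b. \<forall>n\<ge>b. norm ((\<Sum>k<n. p (s @ [k])) - p s) < e" by blast
    qed
  qed
  obtain M :: "real measure" and N where "prob_space M"
    and N[measurable]: "\<And>j. N j \<in> M \<rightarrow>\<^sub>M count_space UNIV"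
    and N_0: "\<And>w. N 0 w = []"
    and N_Suc: "\<And>j w. \<exists>k. N (Suc j) w = N j w @ [k]"
    and N_p: "\<And>s. emeasure M (N (length s) -` {s} \<inter> space M) = p s"
    and N_pos: "\<And>j w. w \<in> space M \<Longrightarrow> 0 < p (N j w)"
    by (rule prob_space_of_consistent_weights[OF p_nonneg p_Nil p_sums]) blast
  interpret M: prob_space M by fact
  have length_N: "length (N j w) = j" for j w
  proof (induction j)
    case (Suc j)
    then show ?case using N_Suc[of j w] by auto
  qed (simp add: N_0)
  have take_N: "take i (N j w) = N i w" if "i \<le> j" for i j w
    using that
  proof (induction rule: dec_induct)
    case (step j)
    then show ?case using N_Suc[of j w] by (auto simp: length_N)
  qed (simp add: length_N)
  \<comment> \<open>A word of positive limit weight is charged by some \<open>Q (r n)\<close>, so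
    its cylinder is nonempty: random words are prefixes of codes of actual points.\<close>
  have ex_word: "\<exists>x. word j x = N j w" if "w \<in> space M" for j w
  proof -
    have "eventually (\<lambda>n. 0 < q (r n) (N j w)) sequentially"
      by (rule order_tendstoD(1)[OF lim N_pos[OF that]])
    then obtain n where "0 < q (r n) (N j w)"
      by (auto simp: eventually_sequentially)
    then have "cyl (N j w) \<noteq> {}" by (auto simp: q_def)
    then show ?thesis by (auto simp: cyl_def length_N)
  qed
  \<comment> \<open>The letter with index \<open>j\<close> is the last one of the word of length
    \<open>Suc j\<close>; \<open>u j w\<close> is the centre it names, within
    \<open>(1 / 2) ^ j\<close> of every point of that cell.\<close>
  define u where "u j w = d (last (N (Suc j) w))" for j w
  have u_word: "dist (u i w) x < (1 / 2) ^ i" if "word (Suc i) x = N (Suc i) w" for i w x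
    using d[of i x] by (simp add: u_def that[symmetric] word_Suc)
  have u_dist: "dist (u i w) (u j w) < 2 * (1 / 2) ^ i" if "w \<in> space M" "i \<le> j" for i j w
  proof -
    obtain x where x: "word (Suc j) x = N (Suc j) w"
      using ex_word[OF \<open>w \<in> space M\<close>] by blast
    then have "word (Suc i) x = N (Suc i) w"
      using take_N[of "Suc i" "Suc j" w] take_word[of "Suc i" "Suc j" x] that(2) by simp
    then have "dist (u i w) x < (1 / 2) ^ i" "dist (u j w) x < (1 / 2) ^ j"
      using u_word x by auto
    moreover have "(1 / 2 :: real) ^ j \<le> (1 / 2) ^ i"
      using that(2) by (intro power_decreasing) auto
    ultimately show ?thesis
      using dist_triangle2[of "u i w" "u j w" x] by linarith
  qed
  have small: "\<exists>i. C * (1 / 2) ^ i < e" if "0 < e" for C e :: real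
  proof -
    have "(\<lambda>i. C * (1 / 2) ^ i) \<longlonglongrightarrow> C * 0"
      by (intro tendsto_mult tendsto_const LIMSEQ_power_zero) simp
    then have "eventually (\<lambda>i. C * (1 / 2) ^ i < e) sequentially"
      using that by (auto dest: order_tendstoD)
    then show ?thesis by (auto simp: eventually_sequentially)
  qed
  define Y where "Y w = lim (\<lambda>j. u j w)" for w
  have u_lim: "(\<lambda>j. u j w) \<longlonglongrightarrow> Y w" if "w \<in> space M" for w
  proof -
    have "Cauchy (\<lambda>j. u j w)"
    proof (rule metric_CauchyI)
      fix e :: real assume "0 < e"
      obtain i where i: "4 * (1 / 2) ^ i < e"
        using small[OF \<open>0 < e\<close>] by blast
      have "dist (u m w) (u n w) < e" if "i \<le> m" "i \<le> n" for m n
        using u_dist[OF \<open>w \<in> space M\<close> \<open>i \<le> m\<close>] u_dist[OF \<open>w \<in> space M\<close> \<open>i \<le> n\<close>] i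
          dist_triangle3[of "u m w" "u n w" "u i w"] by linarith
      then show "\<exists>i. \<forall>m\<ge>i. \<forall>n\<ge>i. dist (u m w) (u n w) < e" by blast
    qed
    then show ?thesis
      unfolding Y_def by (simp add: Cauchy_convergent convergent_LIMSEQ_iff[symmetric])
  qed
  \<comment> \<open>The constant 3 is 1 for the distance from \<open>x\<close> to
    \<open>u i w\<close> plus 2 for that from \<open>u i w\<close> to the limit.\<close>
  have Y_word: "dist x (Y w) \<le> 3 * (1 / 2) ^ i"
    if "w \<in> space M" "word (Suc i) x = N (Suc i) w" for x w i
  proof -
    have "dist (u i w) (Y w) \<le> 2 * (1 / 2) ^ i"
      using u_dist[OF that(1)]
      by (intro LIMSEQ_le_const2[OF tendsto_dist[OF tendsto_const u_lim[OF that(1)]]])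
        (auto intro: less_imp_le)
    with u_word[OF that(2)] show ?thesis
      using dist_triangle3[of x "Y w" "u i w"] by linarith
  qed
  have [measurable]: "u j \<in> borel_measurable M" for j
    unfolding u_def by measurable
  have Y[measurable]: "Y \<in> borel_measurable M"
    by (rule borel_measurable_LIMSEQ_metric[OF _ u_lim]) measurable
  define R where "R = distr M borel Y"
  have R: "R \<in> prob_measures"
    by (simp add: R_def prob_measures_def M.prob_space_distr)
  have "(\<integral>\<^sup>+z. f z \<partial>(R \<Otimes>\<^sub>M R)) \<le> liminf (\<lambda>n. \<integral>\<^sup>+z. f z \<partial>(Q (r n) \<Otimes>\<^sub>M Q (r n)))"
    if f: "lower_semicontinuous f" for f
  proof -
    have [measurable]: "f \<in> borel_measurable (borel \<Otimes>\<^sub>M borel)"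
      using lower_semicontinuous_measurable[OF f] by (simp add: borel_prod)
    \<comment> \<open>The largest minorant of \<open>f\<close> that sees only the two words of level
      \<open>j\<close>. At fixed \<open>j\<close> the limit in \<open>n\<close> is a matter of
      countable series; as \<open>j\<close> grows, the cells shrink to \<open>(Y w, Y w')\<close>
      and semicontinuity recovers \<open>f\<close> there.\<close>
    define h where "h j t = (INF z\<in>{(x, x'). word j x = fst t \<and> word j x' = snd t}. f z)" for j t
    have f_le: "f (Y w, Y w') \<le> liminf (\<lambda>j. h j (N j w, N j w'))"
      if w: "w \<in> space M" "w' \<in> space M" for w w'
      unfolding le_Liminf_iff
    proof (intro allI impI)
      fix y assume "y < f (Y w, Y w')"
      then obtain b where b: "y < b" "b < f (Y w, Y w')"
        using dense by blast
      have "open {z. b < f z}"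
        using f by (simp add: lower_semicontinuous_def)
      moreover have "(Y w, Y w') \<in> {z. b < f z}"
        using b by simp
      ultimately obtain A B where AB: "open A" "open B" "(Y w, Y w') \<in> A \<times> B" "A \<times> B \<subseteq> {z. b < f z}"
        by (rule open_prod_elim)
      obtain e1 e2 where e1: "0 < e1" "ball (Y w) e1 \<subseteq> A" and e2: "0 < e2" "ball (Y w') e2 \<subseteq> B"
        using AB by (meson mem_Sigma_iff open_contains_ball)
      obtain i where i: "3 * (1 / 2) ^ i < min e1 e2"
        using small[of "min e1 e2" 3] e1 e2 by auto
      have "y < h j (N j w, N j w')" if ij: "Suc i \<le> j" for j
      proof -
        have "b \<le> f (x, x')" if "word j x = N j w" "word j x' = N j w'" for x x'
        proof -
          have "word (Suc i) x = N (Suc i) w" "word (Suc i) x' = N (Suc i) w'"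
            using take_word[OF ij] take_N[OF ij] that by metis+
          then have "dist x (Y w) < e1" "dist x' (Y w') < e2"
            using Y_word w i by fastforce+
          then have "(x, x') \<in> A \<times> B"
            using e1 e2 by (auto simp: dist_commute)
          then show ?thesis using AB by auto
        qed
        then have "b \<le> h j (N j w, N j w')"
          unfolding h_def by (intro INF_greatest) auto
        with b show ?thesis by simp
      qed
      then show "eventually (\<lambda>j. y < h j (N j w, N j w')) sequentially"
        by (auto simp: eventually_sequentially)
    qed
    have h_le: "(\<integral>\<^sup>+(w, w'). h j (N j w, N j w') \<partial>(M \<Otimes>\<^sub>M M))
        \<le> liminf (\<lambda>n. \<integral>\<^sup>+z. f z \<partial>(Q (r n) \<Otimes>\<^sub>M Q (r n)))" for j
    proof -
      have "(\<lambda>n. emeasure (Q (r n)) (word j -` {s} \<inter> space (Q (r n)))) \<longlonglongrightarrow>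
          emeasure M (N j -` {s} \<inter> space M)" for s
      proof (cases "length s = j")
        case True
        have "(\<lambda>n. ennreal (q (r n) s)) \<longlonglongrightarrow> ennreal (p s)"
          by (intro tendsto_ennrealI lim)
        moreover have "emeasure (Q n) (cyl s) = q n s" for n
          using prob_space.finite_measure[OF prob_Q]
          by (simp add: q_def finite_measure.emeasure_eq_measure)
        ultimately show ?thesis
          using True N_p[of s] by (simp add: word_pre space_Q)
      next
        case False
        then have "N j -` {s} \<inter> space M = {}" using length_N by auto
        with False show ?thesis by (simp add: word_pre)
      qed
      then have "(\<integral>\<^sup>+(w, w'). h j (N j w, N j w') \<partial>(M \<Otimes>\<^sub>M M))
          \<le> liminf (\<lambda>n. \<integral>\<^sup>+(x, x'). h j (word j x, word j x') \<partial>(Q (r n) \<Otimes>\<^sub>M Q (r n)))"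
        by (intro nn_integral_pair_countable_liminf M.prob_space_axioms prob_Q) measurable
      also have "\<dots> \<le> liminf (\<lambda>n. \<integral>\<^sup>+z. f z \<partial>(Q (r n) \<Otimes>\<^sub>M Q (r n)))"
        by (intro Liminf_mono always_eventually allI nn_integral_mono)
          (auto simp: h_def intro!: INF_lower)
      finally show ?thesis .
    qed
    have [measurable]: "(\<lambda>(w, w'). h j (N j w, N j w')) \<in> borel_measurable (M \<Otimes>\<^sub>M M)" for j
    proof -
      have "(\<lambda>z. (N j (fst z), N j (snd z))) \<in> M \<Otimes>\<^sub>M M \<rightarrow>\<^sub>M count_space UNIV \<Otimes>\<^sub>M count_space UNIV"
        by measurable
      then have [measurable]: "(\<lambda>z. (N j (fst z), N j (snd z))) \<in> M \<Otimes>\<^sub>M M \<rightarrow>\<^sub>M count_space UNIV"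
        by (simp add: pair_measure_countable)
      have "(\<lambda>z. h j (N j (fst z), N j (snd z))) \<in> borel_measurable (M \<Otimes>\<^sub>M M)"
        by measurable
      then show ?thesis by (simp add: case_prod_beta')
    qed
    have "R \<Otimes>\<^sub>M R = distr (M \<Otimes>\<^sub>M M) (borel \<Otimes>\<^sub>M borel) (\<lambda>(w, w'). (Y w, Y w'))"
      unfolding R_def
      by (intro pair_measure_distr) (simp_all add: M.prob_space_distr prob_space_imp_sigma_finite)
    then have "(\<integral>\<^sup>+z. f z \<partial>(R \<Otimes>\<^sub>M R)) = (\<integral>\<^sup>+(w, w'). f (Y w, Y w') \<partial>(M \<Otimes>\<^sub>M M))"
      by (simp add: nn_integral_distr case_prod_beta')
    also have "\<dots> \<le> (\<integral>\<^sup>+z. liminf (\<lambda>j. case z of (w, w') \<Rightarrow> h j (N j w, N j w')) \<partial>(M \<Otimes>\<^sub>M M))"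
      using f_le by (intro nn_integral_mono) (auto simp: space_pair_measure)
    also have "\<dots> \<le> liminf (\<lambda>j. \<integral>\<^sup>+(w, w'). h j (N j w, N j w') \<partial>(M \<Otimes>\<^sub>M M))"
      by (intro nn_integral_liminf) measurable
    also have "\<dots> \<le> limsup (\<lambda>j. \<integral>\<^sup>+(w, w'). h j (N j w, N j w') \<partial>(M \<Otimes>\<^sub>M M))"
      by (intro Liminf_le_Limsup) simp
    also have "\<dots> \<le> liminf (\<lambda>n. \<integral>\<^sup>+z. f z \<partial>(Q (r n) \<Otimes>\<^sub>M Q (r n)))"
      using h_le by (intro Limsup_bounded always_eventually allI)
    finally show ?thesis .
  qed
  with r R show thesis by (rule that)
qed

section \<open>Lower semicontinuous functions and tightness from bounded cost\<close>

lemma lower_semicontinuous_le_liminf: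
  assumes "lower_semicontinuous f" and lim: "u \<longlonglongrightarrow> x"
  shows "f x \<le> liminf (\<lambda>n. f (u n))"
  unfolding le_Liminf_iff
proof (intro allI impI)
  fix c assume "c < f x"
  have "open {z. c < f z}"
    using assms by (simp add: lower_semicontinuous_def)
  from topological_tendstoD[OF lim this] \<open>c < f x\<close>
  show "eventually (\<lambda>n. c < f (u n)) sequentially"
    by simp
qed

lemma lower_semicontinuous_closed_sublevel:
  "lower_semicontinuous f \<Longrightarrow> closed {x. f x \<le> c}"
  by (simp add: lower_semicontinuous_def closed_def Collect_neg_eq[symmetric] not_le)

lemma lower_semicontinuous_indicator:
  "open U \<Longrightarrow> lower_semicontinuous (indicator U)"
  unfolding lower_semicontinuous_def
proof
  fix c :: ennreal assume "open U"
  have "{x. c < indicator U x} = (if c < 1 then U else {})"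
    by (auto simp: indicator_def not_less)
  then show "open {x. c < indicator U x}"
    using \<open>open U\<close> by simp
qed

text \<open>Fatou's lemma along a convergent sequence; closedness of sublevel sets can be tested by
  sequences because the first space is metric.\<close>

lemma lower_semicontinuous_nn_integral:
  fixes g :: "'a::metric_space \<times> 'b::topological_space \<Rightarrow> ennreal"
  assumes g: "lower_semicontinuous g" and meas: "\<And>x. (\<lambda>y. g (x, y)) \<in> borel_measurable M"
  shows "lower_semicontinuous (\<lambda>x. \<integral>\<^sup>+y. g (x, y) \<partial>M)"
  unfolding lower_semicontinuous_def
proof
  fix c
  have "closed {x. (\<integral>\<^sup>+y. g (x, y) \<partial>M) \<le> c}"
    unfolding closed_sequential_limits
  proof (intro allI impI, elim conjE)
    fix u x assume u: "\<forall>n. u n \<in> {x. (\<integral>\<^sup>+y. g (x, y) \<partial>M) \<le> c}" and lim: "u \<longlonglongrightarrow> x"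
    have "(\<integral>\<^sup>+y. g (x, y) \<partial>M) \<le> (\<integral>\<^sup>+y. liminf (\<lambda>n. g (u n, y)) \<partial>M)"
      using lim
      by (intro nn_integral_mono lower_semicontinuous_le_liminf[OF g] tendsto_Pair tendsto_const)
    also have "\<dots> \<le> liminf (\<lambda>n. \<integral>\<^sup>+y. g (u n, y) \<partial>M)"
      by (intro nn_integral_liminf meas)
    also have "\<dots> \<le> limsup (\<lambda>n. \<integral>\<^sup>+y. g (u n, y) \<partial>M)"
      by (intro Liminf_le_Limsup) simp
    also have "\<dots> \<le> c"
      using u by (intro Limsup_bounded) simp
    finally show "x \<in> {x. (\<integral>\<^sup>+y. g (x, y) \<partial>M) \<le> c}" by simp
  qed
  then show "open {x. c < (\<integral>\<^sup>+y. g (x, y) \<partial>M)}"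
    by (simp add: closed_def Collect_neg_eq[symmetric] not_le)
qed

lemma nn_integral_pair_fst:
  assumes "prob_space M" and [measurable]: "f \<in> borel_measurable M"
  shows "(\<integral>\<^sup>+z. f (fst z) \<partial>(M \<Otimes>\<^sub>M M)) = (\<integral>\<^sup>+x. f x \<partial>M)"
proof -
  interpret prob_space M by fact
  have "(\<integral>\<^sup>+z. f (fst z) \<partial>(M \<Otimes>\<^sub>M M)) = (\<integral>\<^sup>+x. \<integral>\<^sup>+y. f (fst (x, y)) \<partial>M \<partial>M)"
    by (rule nn_integral_fst[symmetric]) measurable
  then show ?thesis
    by (simp add: emeasure_space_1)
qed

text \<open>Markov's inequality: the compact sets are sublevels of \<open>F\<close>, whose
  complements have mass at most \<open>B / \<kappa>\<close> for every \<open>n\<close>.\<close>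

lemma bounded_cost_tight:
  fixes F :: "'a::polish_space \<Rightarrow> ennreal"
  assumes Q: "\<And>n. Q n \<in> prob_measures" and [measurable]: "F \<in> borel_measurable borel"
    and compact: "\<And>\<kappa>::real. 0 < \<kappa> \<Longrightarrow> compact {x. F x \<le> ennreal \<kappa>}"
    and bound: "\<And>n. (\<integral>\<^sup>+x. F x \<partial>Q n) \<le> B" "B < \<infinity>" and "0 < (e::real)"
  shows "\<exists>K. compact K \<and> (\<forall>n. measure (Q n) (- K) \<le> e)"
proof -
  obtain b where b: "B = ennreal b" "0 \<le> b"
    using bound(2) by (cases B) auto
  \<comment> \<open>The added 1 keeps \<open>\<kappa>\<close> positive even when
    \<open>b = 0\<close>.\<close>
  define \<kappa> where "\<kappa> = (b + 1) / e"
  have \<kappa>: "0 < \<kappa>" "1 / \<kappa> * b \<le> e"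
    using b \<open>0 < e\<close> by (auto simp: \<kappa>_def field_simps)
  have "measure (Q n) (- {x. F x \<le> ennreal \<kappa>}) \<le> e" for n
  proof -
    have sets[measurable_cong]: "sets (Q n) = sets borel" and "prob_space (Q n)"
      using Q by (auto simp: prob_measures_def)
    then interpret prob_space "Q n" by simp
    have space: "space (Q n) = UNIV"
      using sets_eq_imp_space_eq[OF sets] by simp
    have "1 \<le> ennreal (1 / \<kappa>) * F x" if "ennreal \<kappa> < F x" for x
    proof -
      have "ennreal (1 / \<kappa>) * ennreal \<kappa> \<le> ennreal (1 / \<kappa>) * F x"
        using that by (intro mult_left_mono) auto
      then show ?thesis using \<kappa>(1) by (simp flip: ennreal_mult)
    qed
    then have "emeasure (Q n) (- {x. F x \<le> ennreal \<kappa>})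
        \<le> emeasure (Q n) {x \<in> UNIV. 1 \<le> ennreal (1 / \<kappa>) * F x}"
      by (intro emeasure_mono) (auto simp: not_le)
    also have "\<dots> \<le> ennreal (1 / \<kappa>) * (\<integral>\<^sup>+x. F x * indicator UNIV x \<partial>Q n)"
      by (rule nn_integral_Markov_inequality) (auto simp: sets)
    also have "\<dots> \<le> ennreal (1 / \<kappa>) * ennreal b"
      using bound(1)[of n] b by (intro mult_left_mono) auto
    also have "\<dots> \<le> ennreal e"
      using \<kappa> b by (simp add: ennreal_leI flip: ennreal_mult)
    finally show ?thesis
      using \<open>0 < e\<close> by (simp add: emeasure_eq_measure)
  qed
  with compact[OF \<kappa>(1)] show ?thesis by blast
qed

text \<open>The statement on a single factor follows from the one on the product, applied to
  \<open>f (fst z)\<close>, because the second factor has mass 1.\<close>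

lemma bounded_cost_limit:
  fixes F :: "'a::polish_space \<Rightarrow> ennreal"
  assumes Q: "\<And>n. Q n \<in> prob_measures" and F: "lower_semicontinuous F"
    and "\<And>\<kappa>::real. 0 < \<kappa> \<Longrightarrow> compact {x. F x \<le> ennreal \<kappa>}"
    and "\<And>n. (\<integral>\<^sup>+x. F x \<partial>Q n) \<le> B" "B < \<infinity>"
  obtains r R where "strict_mono (r :: nat \<Rightarrow> nat)" "R \<in> prob_measures"
    "\<And>f. lower_semicontinuous f \<Longrightarrow>
      (\<integral>\<^sup>+z. f z \<partial>(R \<Otimes>\<^sub>M R)) \<le> liminf (\<lambda>n. \<integral>\<^sup>+z. f z \<partial>(Q (r n) \<Otimes>\<^sub>M Q (r n)))"
    "\<And>f. lower_semicontinuous f \<Longrightarrow>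
      (\<integral>\<^sup>+x. f x \<partial>R) \<le> liminf (\<lambda>n. \<integral>\<^sup>+x. f x \<partial>Q (r n))"
proof -
  obtain r R where r: "strict_mono (r :: nat \<Rightarrow> nat)" and R: "R \<in> prob_measures"
    and lim: "\<And>f. lower_semicontinuous f \<Longrightarrow>
      (\<integral>\<^sup>+z. f z \<partial>(R \<Otimes>\<^sub>M R)) \<le> liminf (\<lambda>n. \<integral>\<^sup>+z. f z \<partial>(Q (r n) \<Otimes>\<^sub>M Q (r n)))"
  proof (rule tight_lower_semicontinuous_limit[of Q, OF Q
        bounded_cost_tight[of Q F B, OF Q lower_semicontinuous_measurable[OF F] assms(3-5)]],
      goal_cases)
    case (3 r R)
    from 3(2-) show ?case by (rule 3(1))
  qed
  have "(\<integral>\<^sup>+x. f x \<partial>R) \<le> liminf (\<lambda>n. \<integral>\<^sup>+x. f x \<partial>Q (r n))" if f: "lower_semicontinuous f" for f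
  proof -
    have f_open: "open {x. c < f x}" for c
      using f unfolding lower_semicontinuous_def by blast
    have "lower_semicontinuous (\<lambda>z :: 'a \<times> 'a. f (fst z))"
      unfolding lower_semicontinuous_def
    proof
      fix c
      from open_vimage_fst[OF f_open[of c]] show "open {z :: 'a \<times> 'a. c < f (fst z)}"
        unfolding vimage_def mem_Collect_eq .
    qed
    from lim[OF this]
    have "(\<integral>\<^sup>+z. f (fst z) \<partial>(R \<Otimes>\<^sub>M R)) \<le>
      liminf (\<lambda>n. \<integral>\<^sup>+z. f (fst z) \<partial>(Q (r n) \<Otimes>\<^sub>M Q (r n)))" .
    moreover have "(\<integral>\<^sup>+z. f (fst z) \<partial>(P \<Otimes>\<^sub>M P)) = (\<integral>\<^sup>+x. f x \<partial>P)" if "P \<in> prob_measures" for P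
    proof (rule nn_integral_pair_fst)
      show "prob_space P" "f \<in> borel_measurable P"
        using that lower_semicontinuous_measurable[OF f]
        by (simp_all add: prob_measures_def measurable_def sets_eq_imp_space_eq[of P borel])
    qed
    ultimately show ?thesis
      using Q R by simp
  qed
  with r R lim show thesis by (rule that)
qed

section \<open>Plans of almost minimal cost on the fibres\<close>

text \<open>An open neighbourhood of a compact subset of \<open>U\<close> can be chosen with closure
  inside \<open>U\<close>, so inner regularity gives \<open>\<mu> \<le> \<nu>\<close> on open sets
  and outer regularity on all Borel sets. Passing to complements turns this into equality, as both
  masses are 1. The weak hypothesis suits limits: semicontinuity controls open sets from one side,
  and limits of points of \<open>V\<close> lie only in its closure.\<close>

lemma prob_measure_eqI_open_closure:
  fixes \<mu> \<nu> :: "'a::polish_space measure"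
  assumes "\<mu> \<in> prob_measures" "\<nu> \<in> prob_measures"
    and le: "\<And>V. open V \<Longrightarrow> emeasure \<mu> V \<le> emeasure \<nu> (closure V)"
  shows "\<mu> = \<nu>"
proof -
  have sets[measurable_cong]: "sets \<mu> = sets borel" "sets \<nu> = sets borel"
    and "prob_space \<mu>" "prob_space \<nu>"
    using assms by (auto simp: prob_measures_def)
  then interpret \<mu>: prob_space \<mu> + \<nu>: prob_space \<nu> by auto
  have space: "space \<mu> = UNIV" "space \<nu> = UNIV"
    using sets by (simp_all add: sets_eq_imp_space_eq)
  have "emeasure \<mu> U \<le> emeasure \<nu> U" if "open U" for U
  proof -
    have "emeasure \<mu> K \<le> emeasure \<nu> U" if "K \<subseteq> U" "compact K" for K
    proof -
      obtain e where e: "0 < e" "(\<Union>x\<in>K. cball x e) \<subseteq> U"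
        by (rule compact_subset_open_imp_cball_epsilon_subset[OF \<open>compact K\<close> \<open>open U\<close> \<open>K \<subseteq> U\<close>])
      \<comment> \<open>Half the radius leaves room for the closure of \<open>V\<close> inside the
        closed balls of radius \<open>e\<close>.\<close>
      define V where "V = (\<Union>x\<in>K. ball x (e / 2))"
      have VK: "open V" "K \<subseteq> V"
        using \<open>0 < e\<close> by (auto simp: V_def)
      have "closure V \<subseteq> U"
      proof
        fix y assume "y \<in> closure V"
        then obtain v where "v \<in> V" "dist v y < e / 2"
          using \<open>0 < e\<close> by (meson closure_approachable half_gt_zero)
        then obtain x where "x \<in> K" "dist x v < e / 2" "dist v y < e / 2"
          by (auto simp: V_def)
        then have "dist x y \<le> e"
          using dist_triangle[of x y v] by simp
        with \<open>x \<in> K\<close> e(2) show "y \<in> U" by (meson UN_I mem_cball subsetD)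
      qed
      have "emeasure \<mu> K \<le> emeasure \<mu> V"
        using VK by (intro emeasure_mono) auto
      also have "\<dots> \<le> emeasure \<nu> (closure V)"
        by (rule le) fact
      also have "\<dots> \<le> emeasure \<nu> U"
        using \<open>closure V \<subseteq> U\<close> \<open>open U\<close> by (intro emeasure_mono) auto
      finally show ?thesis .
    qed
    moreover have "U \<in> sets borel" using that by simp
    ultimately show ?thesis
      by (subst inner_regular[OF sets(1)]) (auto intro!: SUP_least)
  qed
  then have *: "emeasure \<mu> B \<le> emeasure \<nu> B" if "B \<in> sets borel" for B
    using that
    by (subst (1 2) outer_regular) (auto simp: sets intro!: INF_mono)
  show ?thesis
  proof (rule measure_eqI)
    fix B assume "B \<in> sets \<mu>"
    then have B: "B \<in> sets borel" by (simp add: sets)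
    have "measure \<mu> B \<le> measure \<nu> B" "measure \<mu> (- B) \<le> measure \<nu> (- B)"
      using *[OF B] *[of "- B"] B by (auto simp: \<mu>.emeasure_eq_measure \<nu>.emeasure_eq_measure borel_comp)
    moreover have "measure \<mu> (- B) = 1 - measure \<mu> B" "measure \<nu> (- B) = 1 - measure \<nu> B"
      using \<mu>.prob_compl[of B] \<nu>.prob_compl[of B] B by (simp_all add: space sets Compl_eq_Diff_UNIV)
    ultimately show "emeasure \<mu> B = emeasure \<nu> B"
      by (simp add: \<mu>.emeasure_eq_measure \<nu>.emeasure_eq_measure)
  qed (simp add: sets)
qed

text \<open>
  The plans below give the mass of each cell of a fine partition of the base space to
  one point lying over that cell with almost minimal cost. This yields admissible plans in the limit
  without a measurable selection.
\<close>

lemma exists_plan_cost_le_fibre_infimum: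
  fixes \<pi> :: "'a::polish_space \<Rightarrow> 'b::polish_space" and F :: "'a \<Rightarrow> ennreal"
  defines "v \<equiv> \<lambda>y. INF z\<in>{z. \<pi> z = y}. F z"
  assumes \<pi>: "continuous_on UNIV \<pi>" and F: "lower_semicontinuous F"
    and compact: "\<And>\<kappa>::real. 0 < \<kappa> \<Longrightarrow> compact {x. F x \<le> ennreal \<kappa>}"
    and m: "m \<in> prob_measures" and B: "\<And>y. v y \<le> B" "B < \<infinity>"
  shows "v \<in> borel_measurable borel"
    and "\<exists>Q\<in>prob_measures_with_marginal \<pi> m. (\<integral>\<^sup>+x. F x \<partial>Q) \<le> (\<integral>\<^sup>+y. v y \<partial>m)"
proof -
  show v[measurable]: "v \<in> borel_measurable borel"
  proof (rule borel_measurableI_less)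
    fix c
    \<comment> \<open>Rational levels exhibit the set as a countable union of continuous images of
      compact sets; the image of a general Borel set need not be Borel.\<close>
    have "{y. v y < c} = (\<Union>q\<in>{q::rat. 0 < q \<and> ennreal (of_rat q) < c}. \<pi> ` {z. F z \<le> ennreal (of_rat q)})"
    proof (intro set_eqI iffI)
      fix y assume "y \<in> {y. v y < c}"
      then obtain z where z: "\<pi> z = y" "F z < c"
        by (auto simp: v_def INF_less_iff)
      then obtain q :: rat where q: "F z < ennreal (of_rat q)" "ennreal (of_rat q) < c"
        using ennreal_rat_dense by blast
      then have "0 < q"
        by (metis ennreal_neg not_less not_less_zero of_rat_less_eq of_rat_0)
      with z q show "y \<in> (\<Union>q\<in>{q::rat. 0 < q \<and> ennreal (of_rat q) < c}. \<pi> ` {z. F z \<le> ennreal (of_rat q)})"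
        by (auto intro: less_imp_le)
    qed (auto simp: v_def INF_less_iff intro: le_less_trans)
    moreover have "\<pi> ` {z. F z \<le> ennreal (of_rat q)} \<in> sets borel" if "0 < q" for q :: rat
      using that \<pi>
      by (intro borel_closed compact_imp_closed compact_continuous_image compact)
        (auto intro: continuous_on_subset)
    ultimately show "{y \<in> space borel. v y < c} \<in> sets borel"
      by (auto intro!: sets.countable_UN')
  qed
  have \<pi>_meas[measurable]: "\<pi> \<in> borel_measurable borel"
    using \<pi> by (rule borel_measurable_continuous_onI)
  have F_meas[measurable]: "F \<in> borel_measurable borel"
    using F by (rule lower_semicontinuous_measurable)
  have sets_m[measurable_cong]: "sets m = sets borel" and "prob_space m"
    using m by (auto simp: prob_measures_def)
  then interpret m: prob_space m by simp
  have space_m: "space m = UNIV"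
    using sets_eq_imp_space_eq[OF sets_m] by simp
  obtain d :: "nat \<Rightarrow> 'b" and c where c[measurable]: "\<And>j. c j \<in> borel \<rightarrow>\<^sub>M count_space UNIV"
    and d: "\<And>j x. dist (d (c j x)) x < (1 / 2) ^ j"
    by (rule dyadic_index) blast
  define \<epsilon> where "\<epsilon> n = ennreal (1 / real (Suc n))" for n
  have \<epsilon>: "0 < \<epsilon> n" "\<epsilon> n \<le> 1" for n
    by (auto simp: \<epsilon>_def ennreal_le_1)
  have \<epsilon>_lim: "\<epsilon> \<longlonglongrightarrow> 0"
    unfolding \<epsilon>_def ennreal_0[symmetric]
    by (intro tendsto_ennrealI LIMSEQ_Suc lim_1_over_n)
  have ex: "\<exists>z. c n (\<pi> z) = c n y \<and> (\<forall>y'. c n y' = c n y \<longrightarrow> F z \<le> v y' + \<epsilon> n)" for n y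
  proof -
    \<comment> \<open>The infimum over everything above the cell of \<open>y\<close>, hence below
      \<open>v\<close> on the whole cell. It is finite, without which
      \<open>m < m + \<epsilon> n\<close> would fail.\<close>
    define m where "m = (INF z\<in>{z. c n (\<pi> z) = c n y}. F z)"
    have m_le: "m \<le> v y'" if "c n y' = c n y" for y'
      unfolding m_def v_def using that by (intro INF_superset_mono) auto
    have "m < \<infinity>"
      by (rule le_less_trans[OF order_trans[OF m_le[OF refl] B(1)] B(2)])
    then have "m < m + \<epsilon> n"
      using \<epsilon>(1)[of n] ennreal_add_left_cancel_less[of m 0 "\<epsilon> n"] by simp
    then obtain z where "c n (\<pi> z) = c n y" "F z < m + \<epsilon> n"
      unfolding m_def INF_less_iff by auto
    then show ?thesis
      using m_le by (meson add_right_mono less_imp_le order_trans)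
  qed
  define z where "z n i = (SOME z. c n (\<pi> z) = i \<and> (\<forall>y'. c n y' = i \<longrightarrow> F z \<le> v y' + \<epsilon> n))" for n i
  have z: "c n (\<pi> (z n (c n y))) = c n y" "F (z n (c n y)) \<le> v y + \<epsilon> n" for n y
    using someI_ex[OF ex[of n y]] by (auto simp: z_def)
  \<comment> \<open>Measurable because it factors through the index \<open>c n y\<close>. It is only
    nearly a section of \<open>\<pi>\<close>: \<open>\<pi> (\<sigma> n y)\<close> shares a cell with
    \<open>y\<close> but may differ from it, so the marginal is \<open>m\<close> only in the
    limit.\<close>
  define \<sigma> where "\<sigma> n y = z n (c n y)" for n y
  have \<sigma>[measurable]: "\<sigma> n \<in> borel_measurable borel" for n
    unfolding \<sigma>_def by measurable
  define Q where "Q n = distr m borel (\<sigma> n)" for n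
  have Q: "Q n \<in> prob_measures" for n
    by (simp add: Q_def prob_measures_def m.prob_space_distr)
  have Q_cost: "(\<integral>\<^sup>+x. F x \<partial>Q n) \<le> (\<integral>\<^sup>+y. v y \<partial>m) + \<epsilon> n" for n
  proof -
    have "(\<integral>\<^sup>+x. F x \<partial>Q n) \<le> (\<integral>\<^sup>+y. v y + \<epsilon> n \<partial>m)"
      unfolding Q_def using z(2) by (auto simp: nn_integral_distr \<sigma>_def intro!: nn_integral_mono)
    also have "\<dots> = (\<integral>\<^sup>+y. v y \<partial>m) + \<epsilon> n"
      by (simp add: nn_integral_add m.emeasure_space_1)
    finally show ?thesis .
  qed
  have "(\<integral>\<^sup>+y. v y \<partial>m) \<le> (\<integral>\<^sup>+y. B \<partial>m)"
    using B(1) by (intro nn_integral_mono)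
  then have v_int: "(\<integral>\<^sup>+y. v y \<partial>m) \<le> B"
    by (simp add: m.emeasure_space_1)
  have Q_bdd: "(\<integral>\<^sup>+x. F x \<partial>Q n) \<le> B + 1" for n
    using Q_cost[of n] v_int \<epsilon>(2)[of n] by (meson add_mono order_trans)
  have B1: "B + 1 < \<infinity>"
    using B(2) by (simp add: less_top)
  obtain r R where r: "strict_mono (r :: nat \<Rightarrow> nat)" and R: "R \<in> prob_measures"
    and lim: "\<And>f. lower_semicontinuous f \<Longrightarrow>
      (\<integral>\<^sup>+x. f x \<partial>R) \<le> liminf (\<lambda>n. \<integral>\<^sup>+x. f x \<partial>Q (r n))"
  proof (rule bounded_cost_limit[of Q F "B + 1", OF Q F compact Q_bdd B1], goal_cases)
    case (2 r R)
    from 2(2,3,5) show ?case by (rule 2(1))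
  qed
  have sets_R[measurable_cong]: "sets R = sets borel" and prob_R: "prob_space R"
    using R by (auto simp: prob_measures_def)
  have "(\<integral>\<^sup>+x. F x \<partial>R) \<le> liminf (\<lambda>n. \<integral>\<^sup>+x. F x \<partial>Q (r n))"
    by (rule lim[OF F])
  also have "\<dots> \<le> liminf (\<lambda>n. (\<integral>\<^sup>+y. v y \<partial>m) + \<epsilon> (r n))"
    using Q_cost by (intro Liminf_mono always_eventually allI)
  also have "\<dots> = (\<integral>\<^sup>+y. v y \<partial>m) + 0"
    using LIMSEQ_subseq_LIMSEQ[OF \<epsilon>_lim r]
    by (intro lim_imp_Liminf tendsto_add tendsto_const) (simp_all add: o_def)
  finally have R_cost: "(\<integral>\<^sup>+x. F x \<partial>R) \<le> (\<integral>\<^sup>+y. v y \<partial>m)" by simp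
  \<comment> \<open>Since \<open>\<pi> (\<sigma> n y)\<close> tends to \<open>y\<close>, it
    eventually leaves an open \<open>V\<close> whose closure misses \<open>y\<close>. Semicontinuity
    on the preimage of \<open>V\<close>, followed by reverse Fatou with dominating function 1, gives
    the comparison of \<open>V\<close> with \<open>closure V\<close>.\<close>
  have "distr R borel \<pi> = m"
  proof (rule prob_measure_eqI_open_closure)
    show "distr R borel \<pi> \<in> prob_measures"
      using prob_R by (simp add: prob_measures_def prob_space.prob_space_distr)
    show "m \<in> prob_measures" by (rule m)
    fix V :: "'b set" assume V: "open V"
    then have [measurable]: "V \<in> sets borel" by simp
    have U: "open (\<pi> -` V)"
      using \<pi> V by (simp add: continuous_on_open_vimage)
    then have [measurable]: "\<pi> -` V \<in> sets borel" by simp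
    have "emeasure (distr R borel \<pi>) V = (\<integral>\<^sup>+x. indicator (\<pi> -` V) x \<partial>R)"
      using sets_eq_imp_space_eq[OF sets_R] by (simp add: emeasure_distr)
    also have "\<dots> \<le> liminf (\<lambda>n. \<integral>\<^sup>+x. indicator (\<pi> -` V) x \<partial>Q (r n))"
      by (intro lim lower_semicontinuous_indicator U)
    also have "\<dots> \<le> limsup (\<lambda>n. \<integral>\<^sup>+x. indicator (\<pi> -` V) x \<partial>Q (r n))"
      by (intro Liminf_le_Limsup) simp
    also have "\<dots> = limsup (\<lambda>n. \<integral>\<^sup>+y. indicator (\<pi> -` V) (\<sigma> (r n) y) \<partial>m)"
      unfolding Q_def by (subst nn_integral_distr) simp_all
    also have "\<dots> \<le> (\<integral>\<^sup>+y. limsup (\<lambda>n. indicator (\<pi> -` V) (\<sigma> (r n) y)) \<partial>m)"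
      by (rule nn_integral_limsup[where w = "\<lambda>_. 1"])
        (auto simp: m.emeasure_space_1 indicator_def)
    also have "\<dots> \<le> (\<integral>\<^sup>+y. indicator (closure V) y \<partial>m)"
    proof (intro nn_integral_mono)
      fix y
      show "limsup (\<lambda>n. indicator (\<pi> -` V) (\<sigma> (r n) y)) \<le> (indicator (closure V) y :: ennreal)"
      proof (cases "y \<in> closure V")
        case True
        then show ?thesis by (intro Limsup_bounded) (auto simp: indicator_def)
      next
        case False
        then obtain e where e: "0 < e" "\<And>w. w \<in> V \<Longrightarrow> e \<le> dist w y"
          by (auto simp: closure_approachable not_less)
        have dist: "dist (\<pi> (\<sigma> n y)) y < 2 * (1 / 2) ^ n" for n
          using d[of n "\<pi> (\<sigma> n y)"] d[of n y] z(1)[of n y]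
            dist_triangle3[of "\<pi> (\<sigma> n y)" y "d (c n y)"] by (simp add: \<sigma>_def)
        have "(\<lambda>n. 2 * (1 / 2) ^ n :: real) \<longlonglongrightarrow> 2 * 0"
          by (intro tendsto_mult tendsto_const LIMSEQ_power_zero) simp
        from LIMSEQ_subseq_LIMSEQ[OF this r] e(1)
        have "eventually (\<lambda>n. 2 * (1 / 2) ^ r n < e) sequentially"
          unfolding o_def by (intro order_tendstoD(2)) auto
        then have "eventually (\<lambda>n. \<pi> (\<sigma> (r n) y) \<notin> V) sequentially"
        proof eventually_elim
          case (elim n)
          with e(2)[of "\<pi> (\<sigma> (r n) y)"] dist[of "r n"] show ?case by auto
        qed
        then show ?thesis
          using False by (intro Limsup_bounded) (auto elim: eventually_mono)
      qed
    qed
    also have "\<dots> = emeasure m (closure V)"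
      by (simp add: sets_m)
    finally show "emeasure (distr R borel \<pi>) V \<le> emeasure m (closure V)" .
  qed
  then show "\<exists>Q\<in>prob_measures_with_marginal \<pi> m. (\<integral>\<^sup>+x. F x \<partial>Q) \<le> (\<integral>\<^sup>+y. v y \<partial>m)"
    using R R_cost by (auto simp: prob_measures_with_marginal_def)
qed

section \<open>Optimality and equilibria\<close>

text \<open>A Bernoulli variable with parameter \<open>t\<close> chooses between \<open>Q'\<close>
  and \<open>Q\<close>; the Giry monad supplies both the probability measure and its integral
  formula.\<close>

lemma exists_mixture:
  fixes Q Q' :: "'a::topological_space measure"
  assumes Q: "Q \<in> prob_measures" and Q': "Q' \<in> prob_measures" and t: "0 \<le> t" "t \<le> 1"
  obtains R where "R \<in> prob_measures"
    "\<And>f. f \<in> borel_measurable borel \<Longrightarrow>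
      (\<integral>\<^sup>+x. f x \<partial>R) = ennreal t * (\<integral>\<^sup>+x. f x \<partial>Q') + ennreal (1 - t) * (\<integral>\<^sup>+x. f x \<partial>Q)"
proof -
  define K where "K b = (if b then Q' else Q)" for b
  have "Q \<in> space (prob_algebra borel)" "Q' \<in> space (prob_algebra borel)"
    using Q Q' by (simp_all add: space_prob_algebra prob_measures_def)
  then have K: "K \<in> measure_pmf (bernoulli_pmf t) \<rightarrow>\<^sub>M prob_algebra borel"
    by (auto simp: K_def)
  define R where "R = measure_pmf (bernoulli_pmf t) \<bind> K"
  have "measure_pmf (bernoulli_pmf t) \<in> space (prob_algebra (measure_pmf (bernoulli_pmf t)))"
    by (simp add: space_prob_algebra measure_pmf.prob_space_axioms)
  show thesis
  proof (rule that)
    show "R \<in> prob_measures"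
      unfolding R_def prob_measures_def
      using prob_space_bind'[OF \<open>measure_pmf _ \<in> _\<close> K] sets_bind'[OF \<open>measure_pmf _ \<in> _\<close> K] by simp
    show "(\<integral>\<^sup>+x. f x \<partial>R) = ennreal t * (\<integral>\<^sup>+x. f x \<partial>Q') + ennreal (1 - t) * (\<integral>\<^sup>+x. f x \<partial>Q)"
      if "f \<in> borel_measurable borel" for f
      unfolding R_def using t
      by (simp add: nn_integral_bind[OF that measurable_prob_algebraD[OF K]] K_def mult.commute)
  qed
qed

text \<open>The right side minus \<open>a\<close> equals \<open>t * (2 * (b - a) + t * k)\<close>
  with \<open>k = a - 2 * b + c\<close>, so dividing by \<open>t\<close> and making \<open>t\<close>
  small forces \<open>b - a\<close> to be nonnegative.\<close>

lemma le_of_quadratic_minimum: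
  fixes a b c :: real
  assumes "\<And>t. 0 < t \<Longrightarrow> t < 1 \<Longrightarrow> a \<le> (1 - t)\<^sup>2 * a + 2 * t * (1 - t) * b + t\<^sup>2 * c"
  shows "a \<le> b"
proof (rule field_le_epsilon)
  fix e :: real assume "0 < e"
  define k where "k = a - 2 * b + c"
  \<comment> \<open>Chosen to give \<open>t * k \<le> e\<close> and \<open>t < 1\<close>; the added
    1 avoids division by zero when \<open>k = 0\<close>.\<close>
  define t where "t = min (1 / 2) (e / (\<bar>k\<bar> + 1))"
  have t: "0 < t" "t < 1"
    using \<open>0 < e\<close> by (auto simp: t_def min_less_iff_disj)
  have "t \<le> e / (\<bar>k\<bar> + 1)"
    by (simp add: t_def)
  then have "t * (\<bar>k\<bar> + 1) \<le> e"
    by (simp add: pos_le_divide_eq)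
  moreover have "t * k \<le> t * (\<bar>k\<bar> + 1)"
    using t by (intro mult_left_mono) auto
  ultimately have "t * k \<le> e" by simp
  have "0 \<le> t * (2 * (b - a) + t * k)"
    using assms[OF t] by (simp add: k_def power2_eq_square algebra_simps)
  then have "0 \<le> 2 * (b - a) + t * k"
    using t by (simp add: zero_le_mult_iff)
  with \<open>t * k \<le> e\<close> \<open>0 < e\<close> show "a \<le> b + e" by simp
qed

text \<open>Along the mixture the energy is a quadratic polynomial in \<open>t\<close> whose two
  mixed terms agree by symmetry and Tonelli. Hypothesis \<open>min\<close> is phrased for measures
  that integrate like a mixture, so that a constrained minimum qualifies once such measures are
  shown to be admissible.\<close>

lemma quadratic_minimum_first_order:
  fixes g :: "'a::second_countable_topology \<times> 'a \<Rightarrow> ennreal"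
  assumes g[measurable]: "g \<in> borel_measurable borel" and sym: "\<And>x y. g (x, y) = g (y, x)"
    and Q: "Q \<in> prob_measures" and Q': "Q' \<in> prob_measures"
    and min: "\<And>t R. \<lbrakk>R \<in> prob_measures;
        \<And>f. f \<in> borel_measurable borel \<Longrightarrow>
          (\<integral>\<^sup>+x. f x \<partial>R) = ennreal t * (\<integral>\<^sup>+x. f x \<partial>Q') + ennreal (1 - t) * (\<integral>\<^sup>+x. f x \<partial>Q);
        0 < t; t < 1\<rbrakk> \<Longrightarrow> (\<integral>\<^sup>+z. g z \<partial>(Q \<Otimes>\<^sub>M Q)) \<le> (\<integral>\<^sup>+z. g z \<partial>(R \<Otimes>\<^sub>M R))"
    and fin: "(\<integral>\<^sup>+z. g z \<partial>(Q \<Otimes>\<^sub>M Q)) < \<infinity>" "(\<integral>\<^sup>+z. g z \<partial>(Q' \<Otimes>\<^sub>M Q')) < \<infinity>"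
  shows "(\<integral>\<^sup>+z. g z \<partial>(Q \<Otimes>\<^sub>M Q)) \<le> (\<integral>\<^sup>+x. \<integral>\<^sup>+y. g (x, y) \<partial>Q \<partial>Q')"
proof -
  have [measurable]: "g \<in> borel_measurable (borel \<Otimes>\<^sub>M borel)"
    by (simp add: borel_prod)
  have pair: "(\<integral>\<^sup>+z. g z \<partial>(R \<Otimes>\<^sub>M R)) = (\<integral>\<^sup>+x. \<integral>\<^sup>+y. g (x, y) \<partial>R \<partial>R)"
    if "R \<in> prob_measures" for R
  proof -
    have [measurable_cong]: "sets R = sets borel" and "prob_space R"
      using that by (auto simp: prob_measures_def)
    then interpret prob_space R by simp
    show ?thesis by (rule nn_integral_fst[symmetric]) measurable
  qed
  have sets[measurable_cong]: "sets Q = sets borel" "sets Q' = sets borel"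
    and prob: "prob_space Q" "prob_space Q'"
    using Q Q' by (auto simp: prob_measures_def)
  interpret Q: prob_space Q by fact
  interpret Q': prob_space Q' by fact
  interpret QQ': pair_sigma_finite Q' Q ..
  have cross: "(\<integral>\<^sup>+x. \<integral>\<^sup>+y. g (x, y) \<partial>Q' \<partial>Q) = (\<integral>\<^sup>+x. \<integral>\<^sup>+y. g (x, y) \<partial>Q \<partial>Q')"
  proof -
    have "(\<integral>\<^sup>+x. \<integral>\<^sup>+y. g (x, y) \<partial>Q' \<partial>Q) = (\<integral>\<^sup>+x. \<integral>\<^sup>+y. g (y, x) \<partial>Q' \<partial>Q)"
      by (subst sym) simp
    also have "\<dots> = (\<integral>\<^sup>+x. \<integral>\<^sup>+y. g (x, y) \<partial>Q \<partial>Q')"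
      by (rule QQ'.Fubini') measurable
    finally show ?thesis .
  qed
  have [measurable]: "(\<lambda>x. \<integral>\<^sup>+y. g (x, y) \<partial>Q) \<in> borel_measurable borel"
    "(\<lambda>x. \<integral>\<^sup>+y. g (x, y) \<partial>Q') \<in> borel_measurable borel"
    by measurable
  define A where "A = (\<integral>\<^sup>+x. \<integral>\<^sup>+y. g (x, y) \<partial>Q \<partial>Q)"
  define B where "B = (\<integral>\<^sup>+x. \<integral>\<^sup>+y. g (x, y) \<partial>Q \<partial>Q')"
  define C where "C = (\<integral>\<^sup>+x. \<integral>\<^sup>+y. g (x, y) \<partial>Q' \<partial>Q')"
  have main: "A \<le> ennreal t * (ennreal t * C + ennreal (1 - t) * B) +
      ennreal (1 - t) * (ennreal t * B + ennreal (1 - t) * A)" if t: "0 < t" "t < 1" for t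
  proof -
    obtain R where R: "R \<in> prob_measures" and int: "\<And>f. f \<in> borel_measurable borel \<Longrightarrow>
        (\<integral>\<^sup>+x. f x \<partial>R) = ennreal t * (\<integral>\<^sup>+x. f x \<partial>Q') + ennreal (1 - t) * (\<integral>\<^sup>+x. f x \<partial>Q)"
      using exists_mixture[OF Q Q', of t] t by (metis less_imp_le)
    have inner: "(\<integral>\<^sup>+y. g (x, y) \<partial>R) =
        ennreal t * (\<integral>\<^sup>+y. g (x, y) \<partial>Q') + ennreal (1 - t) * (\<integral>\<^sup>+y. g (x, y) \<partial>Q)" for x
      by (rule int) measurable
    have "A \<le> (\<integral>\<^sup>+x. \<integral>\<^sup>+y. g (x, y) \<partial>R \<partial>R)"
      using min[OF R int t] by (simp add: pair Q R A_def)
    also have "\<dots> = ennreal t * (\<integral>\<^sup>+x. (\<integral>\<^sup>+y. g (x, y) \<partial>R) \<partial>Q') +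
        ennreal (1 - t) * (\<integral>\<^sup>+x. (\<integral>\<^sup>+y. g (x, y) \<partial>R) \<partial>Q)"
      unfolding inner by (rule int) measurable
    also have "\<dots> = ennreal t * (ennreal t * C + ennreal (1 - t) * B) +
        ennreal (1 - t) * (ennreal t * B + ennreal (1 - t) * A)"
      unfolding inner A_def B_def C_def
      by (simp add: nn_integral_add nn_integral_cmult cross)
    finally show ?thesis .
  qed
  \<comment> \<open>An infinite mixed term leaves nothing to prove; otherwise \<open>fin\<close>
    makes all three coefficients real, and subtraction is available.\<close>
  have "A \<le> B"
  proof (cases "B = \<infinity>")
    case False
    moreover have "A < \<infinity>" "C < \<infinity>"
      using fin by (simp_all add: pair Q Q' A_def C_def)
    ultimately obtain a b c where abc: "A = ennreal a" "B = ennreal b" "C = ennreal c"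
      "0 \<le> a" "0 \<le> b" "0 \<le> c"
      by (cases A; cases B; cases C) auto
    have "a \<le> b"
    proof (rule le_of_quadratic_minimum)
      fix t :: real assume t: "0 < t" "t < 1"
      have "ennreal a \<le> ennreal (t * (t * c + (1 - t) * b) + (1 - t) * (t * b + (1 - t) * a))"
        using main[OF t] t abc by (simp flip: ennreal_mult ennreal_plus)
      then have "a \<le> t * (t * c + (1 - t) * b) + (1 - t) * (t * b + (1 - t) * a)"
        using t abc by (subst (asm) ennreal_le_iff) auto
      then show "a \<le> (1 - t)\<^sup>2 * a + 2 * t * (1 - t) * b + t\<^sup>2 * c"
        by (simp add: power2_eq_square algebra_simps)
    qed
    then show ?thesis using abc by (simp add: ennreal_leI)
  qed simp
  then show ?thesis by (simp add: pair Q A_def B_def)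
qed

section \<open>Existence of a minimizer, and its equilibrium property\<close>

theorem theorem3p25:
  fixes \<pi> :: "'a::polish_space \<Rightarrow> 'b::polish_space"
    and L :: "'a \<Rightarrow> ennreal"
    and H :: "'a \<times> 'a \<Rightarrow> ennreal"
  assumes "continuous_on UNIV \<pi>"
    and "lower_semicontinuous L"
    and "H \<in> borel_measurable borel"
    and "lower_semicontinuous (\<lambda>(x, x'). L x + L x' + H (x, x'))"
    and "\<exists>\<kappa>::real. \<kappa> > 0 \<and> (\<forall>y. \<exists>x. \<pi> x = y \<and> L x \<le> ennreal \<kappa>)"
    and "\<forall>\<kappa>::real. \<kappa> > 0 \<longrightarrow> compact {x. L x \<le> ennreal \<kappa>}"
    and "\<exists>C::real. C > 0 \<and> (\<forall>x x'. H (x, x') \<le> ennreal C * (L x + L x' + 1))"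
  shows "\<forall>m\<^sub>0 \<in> prob_measures.
     (\<exists>Q \<in> prob_measures_with_marginal \<pi> m\<^sub>0.
        \<forall>Q' \<in> prob_measures_with_marginal \<pi> m\<^sub>0. potential L H Q \<le> potential L H Q') \<and>
     ((\<forall>x x'. H (x, x') = H (x', x)) \<longrightarrow> (\<exists>Q. is_NAG_equilibrium \<pi> L H m\<^sub>0 Q))"
proof -
  note \<pi> = assms(1) and L = assms(2) and H = assms(3) and g_lsc = assms(4)
  have compact_L: "compact {x. L x \<le> ennreal \<kappa>}" if "0 < \<kappa>" for \<kappa> :: real
    using assms(6) that by blast
  obtain \<kappa> :: real where \<kappa>: "0 < \<kappa>" "\<And>y. \<exists>x. \<pi> x = y \<and> L x \<le> ennreal \<kappa>"
    using assms(5) by blast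
  obtain C :: real where C: "0 < C" "\<And>x x'. H (x, x') \<le> ennreal C * (L x + L x' + 1)"
    using assms(7) by blast
  define g where "g = (\<lambda>(x, x'). L x + L x' + H (x, x'))"
  have g_lsc: "lower_semicontinuous g"
    using g_lsc by (simp add: g_def)
  have [measurable]: "\<pi> \<in> borel_measurable borel"
    using \<pi> by (rule borel_measurable_continuous_onI)
  have [measurable]: "L \<in> borel_measurable borel"
    using L by (rule lower_semicontinuous_measurable)
  have [measurable]: "H \<in> borel_measurable (borel \<Otimes>\<^sub>M borel)"
    using H by (simp add: borel_prod)
  have g_meas: "g \<in> borel_measurable borel"
    using g_lsc by (rule lower_semicontinuous_measurable)
  then have [measurable]: "g \<in> borel_measurable (borel \<Otimes>\<^sub>M borel)"
    by (simp add: borel_prod)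
  have potential: "potential L H Q = (\<integral>\<^sup>+z. g z \<partial>(Q \<Otimes>\<^sub>M Q))" for Q
    by (simp add: potential_def g_def)
  have iterated: "potential L H Q = (\<integral>\<^sup>+x. \<integral>\<^sup>+y. g (x, y) \<partial>Q \<partial>Q)"
    if "Q \<in> prob_measures" for Q
  proof -
    have [measurable_cong]: "sets Q = sets borel" and "prob_space Q"
      using that by (auto simp: prob_measures_def)
    then interpret prob_space Q by simp
    show ?thesis
      unfolding potential by (rule nn_integral_fst[symmetric]) measurable
  qed
  have L_le: "(\<integral>\<^sup>+x. L x \<partial>Q) \<le> potential L H Q" if "Q \<in> prob_measures" for Q
  proof -
    have [measurable_cong]: "sets Q = sets borel" and "prob_space Q"
      using that by (auto simp: prob_measures_def)
    then have "(\<integral>\<^sup>+x. L x \<partial>Q) = (\<integral>\<^sup>+z. L (fst z) \<partial>(Q \<Otimes>\<^sub>M Q))"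
      by (intro nn_integral_pair_fst[symmetric]) measurable
    also have "\<dots> \<le> potential L H Q"
      unfolding potential by (intro nn_integral_mono) (auto simp: g_def add.assoc)
    finally show ?thesis .
  qed
  \<comment> \<open>With \<open>L_le\<close>, finiteness of the potential becomes a condition on the
    integral of \<open>L\<close>; the growth bound on \<open>H\<close> dominates
    \<open>g (x, y)\<close> by a multiple of \<open>L x + L y + 1\<close>.\<close>
  have potential_finite: "potential L H Q < \<infinity>"
    if "Q \<in> prob_measures" and fin: "(\<integral>\<^sup>+x. L x \<partial>Q) < \<infinity>" for Q
  proof -
    have [measurable_cong]: "sets Q = sets borel" and "prob_space Q"
      using that by (auto simp: prob_measures_def)
    then interpret prob_space Q by simp
    define l where "l = (\<integral>\<^sup>+x. L x \<partial>Q)"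
    have "g (x, y) \<le> (1 + ennreal C) * (L x + L y + 1)" for x y
      using C(2)[of x y] add_mono[of "L x + L y" "L x + L y + 1" "H (x, y)" "ennreal C * (L x + L y + 1)"]
      by (simp add: g_def distrib_right)
    then have "potential L H Q \<le> (\<integral>\<^sup>+x. \<integral>\<^sup>+y. (1 + ennreal C) * (L x + L y + 1) \<partial>Q \<partial>Q)"
      unfolding iterated[OF that(1)] by (intro nn_integral_mono)
    also have "\<dots> = (1 + ennreal C) * (l + l + 1)"
      by (simp add: nn_integral_cmult nn_integral_add emeasure_space_1 l_def)
    also have "\<dots> < \<infinity>"
      using fin by (simp add: ennreal_mult_less_top l_def)
    finally show ?thesis .
  qed
  show ?thesis
  proof
    fix m\<^sub>0 :: "'b measure" assume m: "m\<^sub>0 \<in> prob_measures"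
    let ?P = "prob_measures_with_marginal \<pi> m\<^sub>0"
    have P_prob: "Q \<in> prob_measures" if "Q \<in> ?P" for Q
      using that by (simp add: prob_measures_with_marginal_def)
    interpret m: prob_space m\<^sub>0
      using m by (simp add: prob_measures_def)
    have inf_L: "(INF z\<in>{z. \<pi> z = y}. L z) \<le> ennreal \<kappa>" for y
      using \<kappa>(2)[of y] by (auto intro: INF_lower2)
    \<comment> \<open>The fibre construction is applied to \<open>L\<close> itself, whose fibrewise
      infimum is at most \<open>\<kappa>\<close>, to get a competitor of finite potential.\<close>
    obtain Q\<^sub>0 where Q\<^sub>0: "Q\<^sub>0 \<in> ?P"
      "(\<integral>\<^sup>+x. L x \<partial>Q\<^sub>0) \<le> (\<integral>\<^sup>+y. (INF z\<in>{z. \<pi> z = y}. L z) \<partial>m\<^sub>0)"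
      using exists_plan_cost_le_fibre_infimum(2)[OF \<pi> L compact_L m inf_L] by auto
    have "(\<integral>\<^sup>+y. (INF z\<in>{z. \<pi> z = y}. L z) \<partial>m\<^sub>0) \<le> (\<integral>\<^sup>+y. ennreal \<kappa> \<partial>m\<^sub>0)"
      by (intro nn_integral_mono inf_L)
    also have "\<dots> < \<infinity>"
      by (simp add: m.emeasure_space_1)
    finally have "(\<integral>\<^sup>+x. L x \<partial>Q\<^sub>0) < \<infinity>"
      using Q\<^sub>0(2) by (rule le_less_trans[rotated])
    then have J\<^sub>0: "potential L H Q\<^sub>0 < \<infinity>"
      by (rule potential_finite[OF P_prob[OF Q\<^sub>0(1)]])
    define J where "J = (INF Q\<in>?P. potential L H Q)"
    have J_le: "J \<le> potential L H Q" if "Q \<in> ?P" for Q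
      unfolding J_def using that by (rule INF_lower)
    have "J < \<infinity>"
      using J_le[OF Q\<^sub>0(1)] J\<^sub>0 by (rule le_less_trans)
    define \<epsilon> where "\<epsilon> n = ennreal (1 / real (Suc n))" for n
    have \<epsilon>: "0 < \<epsilon> n" "\<epsilon> n \<le> 1" for n
      by (auto simp: \<epsilon>_def ennreal_le_1)
    have \<epsilon>_lim: "\<epsilon> \<longlonglongrightarrow> 0"
      unfolding \<epsilon>_def ennreal_0[symmetric]
      by (intro tendsto_ennrealI LIMSEQ_Suc lim_1_over_n)
    have "\<exists>Q\<in>?P. potential L H Q < J + \<epsilon> n" for n
    proof -
      have "J < J + \<epsilon> n"
        using \<open>J < \<infinity>\<close> \<epsilon>(1)[of n] ennreal_add_left_cancel_less[of J 0 "\<epsilon> n"] by simp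
      then show ?thesis
        by (subst (asm) (1) J_def) (simp only: INF_less_iff)
    qed
    then obtain Q where Q: "\<And>n. Q n \<in> ?P" "\<And>n. potential L H (Q n) < J + \<epsilon> n"
      by metis
    have Q_bdd: "(\<integral>\<^sup>+x. L x \<partial>Q n) \<le> J + 1" for n
    proof -
      have "(\<integral>\<^sup>+x. L x \<partial>Q n) \<le> potential L H (Q n)"
        by (rule L_le[OF P_prob[OF Q(1)]])
      also have "\<dots> \<le> J + \<epsilon> n"
        using Q(2) by (rule less_imp_le)
      also have "\<dots> \<le> J + 1"
        using \<epsilon>(2) by (rule add_left_mono)
      finally show ?thesis .
    qed
    have J_1: "J + 1 < \<infinity>"
      using \<open>J < \<infinity>\<close> by (simp add: less_top)
    obtain r R where r: "strict_mono (r :: nat \<Rightarrow> nat)" and R: "R \<in> prob_measures"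
      and lim2: "\<And>f. lower_semicontinuous f \<Longrightarrow>
        (\<integral>\<^sup>+z. f z \<partial>(R \<Otimes>\<^sub>M R)) \<le> liminf (\<lambda>n. \<integral>\<^sup>+z. f z \<partial>(Q (r n) \<Otimes>\<^sub>M Q (r n)))"
      and lim1: "\<And>f. lower_semicontinuous f \<Longrightarrow>
        (\<integral>\<^sup>+x. f x \<partial>R) \<le> liminf (\<lambda>n. \<integral>\<^sup>+x. f x \<partial>Q (r n))"
    proof (rule bounded_cost_limit[of Q L "J + 1", OF P_prob[OF Q(1)] L compact_L Q_bdd J_1], goal_cases)
      case (2 r R)
      from 2(2-) show ?case by (rule 2(1))
    qed
    have sets_R[measurable_cong]: "sets R = sets borel" and "prob_space R"
      using R by (auto simp: prob_measures_def)
    then interpret R: prob_space R by simp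
    have marginal: "distr R borel \<pi> = m\<^sub>0"
    proof (rule prob_measure_eqI_open_closure)
      show "distr R borel \<pi> \<in> prob_measures"
        by (simp add: prob_measures_def R.prob_space_distr)
      show "m\<^sub>0 \<in> prob_measures" by (rule m)
      fix V :: "'b set" assume V: "open V"
      then have [measurable]: "V \<in> sets borel" by simp
      have U: "open (\<pi> -` V)"
        using \<pi> V by (simp add: continuous_on_open_vimage)
      then have U_borel[measurable]: "\<pi> -` V \<in> sets borel" by simp
      \<comment> \<open>The minimizing plans have marginal exactly \<open>m\<^sub>0\<close>, so the
        liminf over the open preimage is that of a constant.\<close>
      have Q_V: "emeasure (Q n) (\<pi> -` V) = emeasure m\<^sub>0 V" for n
      proof -
        have sets: "sets (Q n) = sets borel" and "distr (Q n) borel \<pi> = m\<^sub>0"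
          using Q(1)[of n] by (auto simp: prob_measures_with_marginal_def prob_measures_def)
        then have "emeasure m\<^sub>0 V = emeasure (distr (Q n) borel \<pi>) V" by simp
        also have "\<dots> = emeasure (Q n) (\<pi> -` V \<inter> space (Q n))"
          using sets by (intro emeasure_distr) (simp_all cong: measurable_cong_sets)
        finally show ?thesis
          using sets_eq_imp_space_eq[OF sets] by simp
      qed
      have sets_Q: "sets (Q n) = sets borel" for n
        using P_prob[OF Q(1)] by (simp add: prob_measures_def)
      have "emeasure (distr R borel \<pi>) V = (\<integral>\<^sup>+x. indicator (\<pi> -` V) x \<partial>R)"
        using sets_eq_imp_space_eq[OF sets_R] by (simp add: emeasure_distr)
      also have "\<dots> \<le> liminf (\<lambda>n. \<integral>\<^sup>+x. indicator (\<pi> -` V) x \<partial>Q (r n))"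
        by (intro lim1 lower_semicontinuous_indicator U)
      also have "\<dots> = emeasure m\<^sub>0 V"
        using U_borel by (simp add: sets_Q Q_V Liminf_const)
      also have "\<dots> \<le> emeasure m\<^sub>0 (closure V)"
        using m by (intro emeasure_mono closure_subset) (simp add: prob_measures_def)
      finally show "emeasure (distr R borel \<pi>) V \<le> emeasure m\<^sub>0 (closure V)" .
    qed
    with R have R_P: "R \<in> ?P"
      by (simp add: prob_measures_with_marginal_def)
    have "potential L H R \<le> liminf (\<lambda>n. potential L H (Q (r n)))"
      unfolding potential by (rule lim2[OF g_lsc])
    also have "\<dots> \<le> liminf (\<lambda>n. J + \<epsilon> (r n))"
      using Q(2) by (intro Liminf_mono always_eventually allI less_imp_le)
    also have "\<dots> = J + 0"
      using LIMSEQ_subseq_LIMSEQ[OF \<epsilon>_lim r]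
      by (intro lim_imp_Liminf tendsto_add tendsto_const) (simp_all add: o_def)
    finally have R_J: "potential L H R \<le> J" by simp
    then have R_min: "potential L H R \<le> potential L H Q'" if "Q' \<in> ?P" for Q'
      using J_le[OF that] by (rule order_trans)
    have R_fin: "potential L H R < \<infinity>"
      using R_J \<open>J < \<infinity>\<close> by (rule le_less_trans)
    have "is_NAG_equilibrium \<pi> L H m\<^sub>0 R" if sym: "\<forall>x x'. H (x, x') = H (x', x)"
    proof -
      define l where "l = (\<integral>\<^sup>+x. L x \<partial>R)"
      define F where "F x = individual_cost L H x R" for x
      have l_fin: "l < \<infinity>"
        unfolding l_def using L_le[OF R] R_fin by (rule le_less_trans)
      have g_F: "(\<integral>\<^sup>+y. g (x, y) \<partial>R) = l + F x" for x
        by (simp add: g_def F_def individual_cost_def l_def nn_integral_add R.emeasure_space_1 ac_simps)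
      \<comment> \<open>Semicontinuity is known for \<open>g\<close> only, so it is first shown for
        \<open>l + F x\<close>; finiteness of \<open>l\<close> then allows cancellation.\<close>
      have "lower_semicontinuous (\<lambda>x. \<integral>\<^sup>+y. g (x, y) \<partial>R)"
        by (intro lower_semicontinuous_nn_integral g_lsc) measurable
      then have lF: "lower_semicontinuous (\<lambda>x. l + F x)"
        by (simp add: g_F)
      have F_lsc: "lower_semicontinuous F"
        unfolding lower_semicontinuous_def
      proof
        fix c
        have "open {x. l + c < l + F x}"
          using lF unfolding lower_semicontinuous_def by blast
        also have "{x. l + c < l + F x} = {x. c < F x}"
          using l_fin by (auto simp: ennreal_add_left_cancel_less)
        finally show "open {x. c < F x}" .
      qed
      then have [measurable]: "F \<in> borel_measurable borel"
        by (rule lower_semicontinuous_measurable)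
      have compact_F: "compact {x. F x \<le> ennreal c}" if "0 < c" for c :: real
      proof -
        have "{x. F x \<le> ennreal c} \<subseteq> {x. L x \<le> ennreal c}"
          by (auto simp: F_def individual_cost_def intro: order_trans[rotated])
        then have "{x. F x \<le> ennreal c} = {x. F x \<le> ennreal c} \<inter> {x. L x \<le> ennreal c}"
          by blast
        then show ?thesis
          using closed_Int_compact[OF lower_semicontinuous_closed_sublevel[OF F_lsc] compact_L[OF that]]
          by metis
      qed
      define v where "v y = (INF z\<in>{z. \<pi> z = y}. F z)" for y
      \<comment> \<open>Bounds \<open>F\<close> at a point over \<open>y\<close> with
        \<open>L x \<le> \<kappa>\<close>: the growth bound on \<open>H\<close>, integrated in the
        second variable, gives the last summand.\<close>
      define B where "B = ennreal \<kappa> + ennreal C * (ennreal \<kappa> + l + 1)"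
      have B_fin: "B < \<infinity>"
        using l_fin by (simp add: B_def ennreal_mult_less_top)
      have v_le: "v y \<le> B" for y
      proof -
        obtain x where x: "\<pi> x = y" "L x \<le> ennreal \<kappa>"
          using \<kappa>(2) by blast
        have "(\<integral>\<^sup>+x'. H (x, x') \<partial>R) \<le> (\<integral>\<^sup>+x'. ennreal C * (ennreal \<kappa> + L x' + 1) \<partial>R)"
          using x(2) by (intro nn_integral_mono order_trans[OF C(2)] mult_left_mono add_right_mono) simp_all
        also have "\<dots> = ennreal C * (ennreal \<kappa> + l + 1)"
          by (simp add: nn_integral_cmult nn_integral_add R.emeasure_space_1 l_def)
        finally have "F x \<le> B"
          using x(2) by (simp add: F_def individual_cost_def B_def add_mono)
        with x(1) show ?thesis
          by (auto simp: v_def intro: INF_lower2)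
      qed
      note plan = exists_plan_cost_le_fibre_infimum[OF \<pi> F_lsc compact_F m v_le[unfolded v_def] B_fin]
      have [measurable]: "v \<in> borel_measurable borel"
        using plan(1) by (simp add: v_def[abs_def])
      obtain Q' where Q': "Q' \<in> ?P" "(\<integral>\<^sup>+x. F x \<partial>Q') \<le> (\<integral>\<^sup>+y. v y \<partial>m\<^sub>0)"
        using plan(2) by (auto simp: v_def)
      have "(\<integral>\<^sup>+y. v y \<partial>m\<^sub>0) \<le> (\<integral>\<^sup>+y. B \<partial>m\<^sub>0)"
        by (intro nn_integral_mono v_le)
      also have "\<dots> < \<infinity>"
        using B_fin by (simp add: m.emeasure_space_1)
      finally have v_fin: "(\<integral>\<^sup>+y. v y \<partial>m\<^sub>0) < \<infinity>" .
      have sets_Q'[measurable_cong]: "sets Q' = sets borel" and "prob_space Q'"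
        and marginal': "distr Q' borel \<pi> = m\<^sub>0"
        using Q'(1) by (auto simp: prob_measures_with_marginal_def prob_measures_def)
      then interpret Q': prob_space Q' by simp
      \<comment> \<open>\<open>Q'\<close> was chosen by its cost \<open>F\<close>; since
        \<open>L \<le> F\<close>, its potential is finite as well, as the first-order condition
        requires.\<close>
      have "(\<integral>\<^sup>+x. L x \<partial>Q') \<le> (\<integral>\<^sup>+x. F x \<partial>Q')"
        by (intro nn_integral_mono) (simp add: F_def individual_cost_def)
      also have "\<dots> < \<infinity>"
        using Q'(2) v_fin by (rule le_less_trans)
      finally have Q'_fin: "potential L H Q' < \<infinity>"
        by (rule potential_finite[OF P_prob[OF Q'(1)]])
      have "potential L H R \<le> (\<integral>\<^sup>+x. \<integral>\<^sup>+y. g (x, y) \<partial>R \<partial>Q')"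
        unfolding potential
      proof (rule quadratic_minimum_first_order[OF g_meas _ R P_prob[OF Q'(1)]])
        show "g (x, y) = g (y, x)" for x y
          using sym by (simp add: g_def ac_simps)
        show "(\<integral>\<^sup>+z. g z \<partial>(R \<Otimes>\<^sub>M R)) < \<infinity>" "(\<integral>\<^sup>+z. g z \<partial>(Q' \<Otimes>\<^sub>M Q')) < \<infinity>"
          using R_fin Q'_fin by (simp_all add: potential)
        fix t :: real and S
        assume S: "S \<in> prob_measures" and t: "0 < t" "t < 1"
          and int: "\<And>f. f \<in> borel_measurable borel \<Longrightarrow>
            (\<integral>\<^sup>+x. f x \<partial>S) = ennreal t * (\<integral>\<^sup>+x. f x \<partial>Q') + ennreal (1 - t) * (\<integral>\<^sup>+x. f x \<partial>R)"
        have sets_S[measurable_cong]: "sets S = sets borel"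
          using S by (simp add: prob_measures_def)
        \<comment> \<open>The marginal constraint is affine, and the weights \<open>t\<close> and
          \<open>1 - t\<close> sum to 1.\<close>
        have "distr S borel \<pi> = m\<^sub>0"
        proof (rule measure_eqI)
          show sets: "sets (distr S borel \<pi>) = sets m\<^sub>0"
            using m by (simp add: prob_measures_def)
          fix A assume "A \<in> sets (distr S borel \<pi>)"
          then have [measurable]: "A \<in> sets borel" by simp
          have eq: "emeasure (distr M borel \<pi>) A = (\<integral>\<^sup>+x. indicator A (\<pi> x) \<partial>M)"
            if [measurable_cong]: "sets M = sets borel" for M
            by (simp add: nn_integral_distr flip: nn_integral_indicator)
          have "emeasure (distr S borel \<pi>) A =
              ennreal t * emeasure m\<^sub>0 A + ennreal (1 - t) * emeasure m\<^sub>0 A"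
            unfolding eq[OF sets_S] by (subst int) (simp_all flip: eq[OF sets_R] eq[OF sets_Q'] add: marginal marginal')
          also have "\<dots> = ennreal (t + (1 - t)) * emeasure m\<^sub>0 A"
            using t by (subst ennreal_plus) (auto simp: distrib_right)
          finally show "emeasure (distr S borel \<pi>) A = emeasure m\<^sub>0 A" by simp
        qed
        then have "S \<in> ?P"
          using S by (simp add: prob_measures_with_marginal_def)
        then show "(\<integral>\<^sup>+z. g z \<partial>(R \<Otimes>\<^sub>M R)) \<le> (\<integral>\<^sup>+z. g z \<partial>(S \<Otimes>\<^sub>M S))"
          unfolding potential[symmetric] by (rule R_min)
      qed
      then have "l + (\<integral>\<^sup>+x. F x \<partial>R) \<le> l + (\<integral>\<^sup>+x. F x \<partial>Q')"
        by (simp add: iterated[OF R] g_F nn_integral_add R.emeasure_space_1 Q'.emeasure_space_1)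
      then have "(\<integral>\<^sup>+x. F x \<partial>R) \<le> (\<integral>\<^sup>+x. F x \<partial>Q')"
        using l_fin by (auto simp: ennreal_add_left_cancel_le)
      also note Q'(2)
      \<comment> \<open>The fibrewise infimum depends on \<open>x\<close> only through
        \<open>\<pi> x\<close>, so its integral is the same for every admissible plan.\<close>
      also have "(\<integral>\<^sup>+y. v y \<partial>m\<^sub>0) = (\<integral>\<^sup>+x. v (\<pi> x) \<partial>R)"
        by (subst marginal[symmetric]) (simp add: nn_integral_distr)
      finally have F_le: "(\<integral>\<^sup>+x. F x \<partial>R) \<le> (\<integral>\<^sup>+x. v (\<pi> x) \<partial>R)" .
      have v_R_fin: "(\<integral>\<^sup>+x. v (\<pi> x) \<partial>R) < \<infinity>"
        using v_fin by (subst (asm) marginal[symmetric]) (simp add: nn_integral_distr)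
      have v_F: "v (\<pi> x) \<le> F x" for x
        unfolding v_def by (rule INF_lower) simp
      \<comment> \<open>The integral of \<open>v (\<pi> x)\<close> is finite, so the difference may
        be integrated termwise; being nonnegative with zero integral, it vanishes almost
        everywhere.\<close>
      have "(\<integral>\<^sup>+x. F x - v (\<pi> x) \<partial>R) = (\<integral>\<^sup>+x. F x \<partial>R) - (\<integral>\<^sup>+x. v (\<pi> x) \<partial>R)"
        using v_R_fin v_F by (intro nn_integral_diff) auto
      also have "\<dots> = 0"
        using F_le v_R_fin by (simp add: diff_eq_0_iff_ennreal)
      finally have "AE x in R. F x - v (\<pi> x) = 0"
        by (subst (asm) nn_integral_0_iff_AE) auto
      then have "AE x in R. F x = v (\<pi> x)"
      proof eventually_elim
        case (elim x)
        then have "F x \<le> v (\<pi> x)"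
          by (simp add: diff_eq_0_iff_ennreal)
        with v_F[of x] show ?case by (rule antisym[rotated])
      qed
      moreover have "(\<integral>\<^sup>+x. F x \<partial>R) < \<infinity>"
        using F_le v_R_fin by (rule le_less_trans)
      ultimately show ?thesis
        using R marginal by (simp add: is_NAG_equilibrium_def F_def v_def)
    qed
    with R_P R_min show "(\<exists>Q\<in>?P. \<forall>Q'\<in>?P. potential L H Q \<le> potential L H Q') \<and>
        ((\<forall>x x'. H (x, x') = H (x', x)) \<longrightarrow> (\<exists>Q. is_NAG_equilibrium \<pi> L H m\<^sub>0 Q))"
      by blast
  qed
qed

end
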